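(* Let $R$ be a partition ring. If $\sum_{m\ge0}r_mt^m\in R[[\Sigma]]$ is an exponential element, then in the ring $\mathrm{PD}(R)[[\Sigma]]$ we have $$\sum_{m\ge0}\eta_m(r_m)t^m=\exp\Big(\sum_{k\ge1}(r_k*\mathbf 1_k)\,t^k\Big),$$ where $r_k*\mathbf 1_k:=\eta_k(r_k)*\mathbf 1_k\in\mathrm{PD}(R)(k)$ and the exponential is interpreted integrally as explained in the context.
   Context: Partitions. A partition $\Lambda=(X,\sim_\Lambda)$ is a finite set $X$ with an equivalence relation; its classes are called blocks. A morphism $f\colon\Lambda\to\Omega=(Y,\sim_\Omega)$ is a bijection $f\colon X\to Y$ with $x\sim_\Lambda x'\Rightarrow f(x)\sim_\Omega f(x')$. There is a (unique) 2-isomorphism $f\Rightarrow g$ between morphisms $f,g\colon\Lambda\to\Omega$ exactly when $f(x)\sim_\Omega g(x)$ for all $x\in X$. This defines a $(2,1)$-category $\mathcal P$; a functor from $\mathcal P$ to an ordinary category identifies 2-isomorphic morphisms. Write $\Lambda\le\Omega$ (refinement) if $X=Y$ and the identity is a morphism $\Lambda\to\Omega$; $\Lambda<\Omega$ if moreover $\Lambda\ne\Omega$. $\Lambda\cap\Gamma$ is the coarsest common refinement; $\Lambda\sqcup\Omega$ is the disjoint union partition. $\underline m$ is $[m]=\{1,\dots,m\}$ with the indiscrete relation ($\underline 0$ is empty); likewise $\underline B$ for a finite set $B$. $\underline i\sqcup\underline j\le\underline{i+j}$ denotes the morphism sending $\underline i$ to the first $i$ and $\underline j$ to the last $j$ elements.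 $\Sigma_\Lambda$ is the group of bijections of $X$ preserving every block. For a morphism $f\colon\Lambda\to\Omega$ and $\Gamma\le\Lambda$, $f\Gamma$ is the transported partition of $Y$ and $f_\Gamma\colon\Gamma\to f\Gamma$ the induced isomorphism. Partition rings. A partition functor $M$ consists of abelian groups $M(\Lambda)$, a contravariant functor $M^*$ (restrictions) and a covariant functor $M_*$ (transfers) from $\mathcal P$ to abelian groups with common values $M(\Lambda)$, with $M_*(f)=M^*(f^{-1})$ for isomorphisms $f$, and for $\Gamma,\Lambda\le\Omega$ $$M^*(\Gamma\le\Omega)M_*(\Lambda\le\Omega)=\sum_{[\sigma]\in\Sigma_\Gamma\backslash\Sigma_\Omega/\Sigma_\Lambda}M_*(\Gamma\cap\sigma\Lambda\le\Gamma)\,M_*(\sigma)\,M^*(\sigma^{-1}\Gamma\cap\Lambda\le\Lambda).$$ It is lax symmetric monoidal if equipped with a unit $\mathbb Z\to M(0)$ and external products $M(\Lambda)\otimes M(\Omega)\to M(\Lambda\sqcup\Omega)$, $x\otimes y\mapsto x\boxtimes y$, natural in pairs of restrictions and pairs of transfers, associative, unital, symmetric. A partition ring $R$ is a lax symmetric monoidal partition functor with each $R(\Lambda)$ a commutative ring (product written $*$), restrictions and external products ring maps, and $R_*(f)(R^*(f)(a)*b)=a*R_*(f)(b)$. Write $R(m)=R(\underline m)$. $\mathrm{PD}$. $I_\Gamma\subseteq R(\Gamma)$ is the sum of images of $R_*(\Omega<\Gamma)$ over $\Omega<\Gamma$; $\bar R(\Gamma)=R(\Gamma)/I_\Gamma$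 with quotient map $q_\Gamma$; for isomorphisms $f$, $\bar R_*(f)$ is induced by $R_*(f)$; external products descend to $\bar R$. $\mathrm{PD}(R)(\Lambda)=(\bigoplus_{\Gamma\le\Lambda}\bar R(\Gamma))^{\Sigma_\Lambda}$ with action $(\sigma x)_\Gamma=\bar R_*(\sigma)(x_{\sigma^{-1}\Gamma})$. It is a partition ring with componentwise product $*$, restriction $(\mathrm{PD}(R)^*(f)x)_\Gamma=\bar R_*(f_\Gamma)^{-1}(x_{f\Gamma})$, transfer along $f\colon\Psi\to\Lambda$ given by $(\mathrm{PD}(R)_*(f)x)_\Gamma=\sum\bar R_*(\sigma f)(x_{(\sigma f)^{-1}\Gamma})$, the sum over $[\sigma]\in\Sigma_\Gamma\backslash\Sigma_\Lambda/\Sigma_{f\Psi}$ with $\Gamma\le\sigma f\Psi$, and external product $(x\boxtimes y)_{\Gamma\sqcup\Theta}=x_\Gamma\boxtimes y_\Theta$. The map $\eta_\Lambda(z)=(q_\Gamma R^*(\Gamma\le\Lambda)z)_{\Gamma\le\Lambda}$ is a map of partition rings $\eta\colon R\to\mathrm{PD}(R)$. The ring $\bar R(m)=R(m)/I_{\underline m}$ is a direct summand of $\mathrm{PD}(R)(m)$ (component $\Gamma=\underline m$), and $\mathbf 1_m\in\mathrm{PD}(R)(m)$ is the multiplicative identity of this summand extended by zero. Rings of symmetric functions. For lax symmetric monoidal $M$, $M[[\Sigma]]=\prod_{m\ge0}M(m)$ is the commutative ring with the transfer product: for $x\in M(i)$, $y\in M(j)$, $xy=M_*(\underline i\sqcup\underline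 j\le\underline{i+j})(x\boxtimes y)$. Elements are written $\sum_m r_mt^m$ with $r_m\in M(m)$, $t$ only tracking the grading. The element is exponential if $r_0=1$ and $M^*(\underline i\sqcup\underline j\le\underline{i+j})(r_{i+j})=r_i\boxtimes r_j$ for all $i,j\ge0$. Integral exponential. For $x_i\in\bar R(i)\subseteq\mathrm{PD}(R)(i)$, $i\ge1$, the coefficient of $t^m$ in $\exp(\sum_ix_it^i)$ is $\sum_{\lambda}\frac1{\lambda!}\prod_ix_i^{\lambda_i}$, the sum over sequences $\lambda=(\lambda_1,\lambda_2,\dots)$ of natural numbers with $\sum_i i\lambda_i=m$, $\lambda!=\prod_i\lambda_i!$, powers in the transfer product. The transfer product $\prod_ix_i^{\lambda_i}$ is canonically $\lambda!$ times the element of $\mathrm{PD}(R)(m)$ whose $\Gamma$-component is the external product $\boxtimes_Bx_{|B|}\in\bar R(\Gamma)$ over the blocks $B$ of $\Gamma$ (each $x_{|B|}$ transported to $\bar R(\underline B)$ along any bijection) if $\Gamma$ has exactly $\lambda_i$ blocks of size $i$ for all $i$, and $0$ otherwise; $\frac1{\lambda!}\prod_ix_i^{\lambda_i}$ denotes this element. *)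

theory Defs
  imports
    "HOL-Algebra.QuotRing"
    "HOL-Combinatorics.Permutations"
    "HOL-Library.Nat_Bijection"
begin

section \<open>Partitions\<close>

text \<open>
  Partitions live on finite sets of natural numbers. These form a full subcategory of the
  category of all finite sets with an equivalence relation that meets every isomorphism class and,
  with disjoint unions formed along \<^const>\<open>sum_encode\<close>, is closed under \<open>\<uplus>\<close>.
\<close>

datatype part = Part (pts: "nat set") (rel: "nat rel")

definition is_partition :: "part \<Rightarrow> bool" where
  "is_partition \<Lambda> \<longleftrightarrow> finite (pts \<Lambda>) \<and> equiv (pts \<Lambda>) (rel \<Lambda>)"

definition blocks :: "part \<Rightarrow> nat set set" where
  "blocks \<Lambda> = pts \<Lambda> // rel \<Lambda>"

definition morphism :: "part \<Rightarrow> part \<Rightarrow> (nat \<Rightarrow> nat) \<Rightarrow> bool" where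
  "morphism \<Lambda> \<Omega> f \<longleftrightarrow> is_partition \<Lambda> \<and> is_partition \<Omega> \<and> bij_betw f (pts \<Lambda>) (pts \<Omega>) \<and>
     (\<forall>x x'. (x, x') \<in> rel \<Lambda> \<longrightarrow> (f x, f x') \<in> rel \<Omega>)"

text \<open>Maps that agree on \<^term>\<open>pts \<Lambda>\<close> are in particular 2-isomorphic, so their values
  elsewhere are irrelevant.\<close>

definition two_iso :: "part \<Rightarrow> part \<Rightarrow> (nat \<Rightarrow> nat) \<Rightarrow> (nat \<Rightarrow> nat) \<Rightarrow> bool" where
  "two_iso \<Lambda> \<Omega> f g \<longleftrightarrow> (\<forall>x\<in>pts \<Lambda>. (f x, g x) \<in> rel \<Omega>)"

definition isomorphism :: "part \<Rightarrow> part \<Rightarrow> (nat \<Rightarrow> nat) \<Rightarrow> bool" where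
  "isomorphism \<Lambda> \<Omega> f \<longleftrightarrow> morphism \<Lambda> \<Omega> f \<and> morphism \<Omega> \<Lambda> (inv_into (pts \<Lambda>) f)"

definition refines_le :: "part \<Rightarrow> part \<Rightarrow> bool" (infix \<open>\<preceq>\<close> 50) where
  "\<Lambda> \<preceq> \<Omega> \<longleftrightarrow> pts \<Lambda> = pts \<Omega> \<and> morphism \<Lambda> \<Omega> id"

definition refines_less :: "part \<Rightarrow> part \<Rightarrow> bool" (infix \<open>\<prec>\<close> 50) where
  "\<Lambda> \<prec> \<Omega> \<longleftrightarrow> \<Lambda> \<preceq> \<Omega> \<and> \<Lambda> \<noteq> \<Omega>"

text \<open>Only used for partitions of the same set.\<close>

definition common_refinement :: "part \<Rightarrow> part \<Rightarrow> part" where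
  "common_refinement \<Lambda> \<Gamma> = Part (pts \<Lambda> \<inter> pts \<Gamma>) (rel \<Lambda> \<inter> rel \<Gamma>)"

definition transport :: "(nat \<Rightarrow> nat) \<Rightarrow> part \<Rightarrow> part" where
  "transport f \<Gamma> = Part (f ` pts \<Gamma>) (map_prod f f ` rel \<Gamma>)"

definition indisc :: "nat set \<Rightarrow> part" where
  "indisc B = Part B (B \<times> B)"

definition std :: "nat \<Rightarrow> part" where
  "std m = indisc {1..m}"

definition Sym :: "part \<Rightarrow> (nat \<Rightarrow> nat) set" where
  "Sym \<Lambda> = {\<sigma>. \<sigma> permutes pts \<Lambda> \<and> (\<forall>B\<in>blocks \<Lambda>. \<sigma> ` B = B)}"

text \<open>\<open>dcosets \<Gamma> \<Omega> \<Lambda>\<close> is the set of double cosets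
  \<open>\<Sigma>\<^sub>\<Gamma> \<setminus> \<Sigma>\<^sub>\<Omega> / \<Sigma>\<^sub>\<Lambda>\<close>.\<close>

definition dcosets :: "part \<Rightarrow> part \<Rightarrow> part \<Rightarrow> (nat \<Rightarrow> nat) set set" where
  "dcosets \<Gamma> \<Omega> \<Lambda> = (\<lambda>\<sigma>. {\<gamma> \<circ> \<sigma> \<circ> \<tau> | \<gamma> \<tau>. \<gamma> \<in> Sym \<Gamma> \<and> \<tau> \<in> Sym \<Lambda>}) ` Sym \<Omega>"

text \<open>Sums over double cosets are evaluated at a chosen representative; the summands below do not
  depend on the choice.\<close>

definition drep :: "(nat \<Rightarrow> nat) set \<Rightarrow> nat \<Rightarrow> nat" where
  "drep D = (SOME \<sigma>. \<sigma> \<in> D)"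


section \<open>Disjoint unions\<close>

definition inl :: "nat \<Rightarrow> nat" where "inl x = sum_encode (Inl x)"
definition inr :: "nat \<Rightarrow> nat" where "inr y = sum_encode (Inr y)"

definition dcase :: "(nat \<Rightarrow> nat) \<Rightarrow> (nat \<Rightarrow> nat) \<Rightarrow> nat \<Rightarrow> nat" where
  "dcase f g n = case_sum f g (sum_decode n)"

definition dsum :: "part \<Rightarrow> part \<Rightarrow> part" (infixr \<open>\<uplus>\<close> 65) where
  "\<Lambda> \<uplus> \<Omega> = Part (inl ` pts \<Lambda> \<union> inr ` pts \<Omega>)
     (map_prod inl inl ` rel \<Lambda> \<union> map_prod inr inr ` rel \<Omega>)"

definition dsum_map :: "(nat \<Rightarrow> nat) \<Rightarrow> (nat \<Rightarrow> nat) \<Rightarrow> nat \<Rightarrow> nat" where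
  "dsum_map f g = dcase (inl \<circ> f) (inr \<circ> g)"

definition dsum_assoc :: "nat \<Rightarrow> nat" where
  "dsum_assoc = dcase (dcase inl (inr \<circ> inl)) (inr \<circ> inr)"

definition dsum_swap :: "nat \<Rightarrow> nat" where
  "dsum_swap = dcase inr inl"

text \<open>Erases the tags. It serves as the unit isomorphisms
  \<open>\<emptyset> \<uplus> \<Lambda> \<rightarrow> \<Lambda>\<close> and \<open>\<Lambda> \<uplus> \<emptyset> \<rightarrow> \<Lambda>\<close>, and
  identifies \<open>\<uplus>\<close> of partitions of disjoint sets with their union.\<close>

definition untag :: "nat \<Rightarrow> nat" where
  "untag = dcase id id"

text \<open>The morphism \<open>std i \<uplus> std j \<rightarrow> std (i + j)\<close>.\<close>

definition concat_map :: "nat \<Rightarrow> nat \<Rightarrow> nat" where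
  "concat_map i = dcase id (\<lambda>y. i + y)"

text \<open>Components of a refinement of \<open>\<Lambda> \<uplus> \<Omega>\<close>; every such refinement is
  \<open>left_part \<Xi> \<uplus> right_part \<Xi>\<close>.\<close>

definition left_part :: "part \<Rightarrow> part" where
  "left_part \<Xi> = Part (inl -` pts \<Xi>) (map_prod inl inl -` rel \<Xi>)"

definition right_part :: "part \<Rightarrow> part" where
  "right_part \<Xi> = Part (inr -` pts \<Xi>) (map_prod inr inr -` rel \<Xi>)"


section \<open>Partition functors and partition rings\<close>

text \<open>
  \<open>res M \<Lambda> \<Omega> f\<close> and \<open>tr M \<Lambda> \<Omega> f\<close> are the restriction and the transfer along
  \<open>f : \<Lambda> \<rightarrow> \<Omega>\<close>. In \<open>partition_functor\<close> and \<open>lax_partition_functor\<close>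
  only the additive part of the record \<open>val M \<Lambda>\<close> matters.
\<close>

record 'a pfunctor =
  val :: "part \<Rightarrow> 'a ring"
  res :: "part \<Rightarrow> part \<Rightarrow> (nat \<Rightarrow> nat) \<Rightarrow> 'a \<Rightarrow> 'a"
  tr :: "part \<Rightarrow> part \<Rightarrow> (nat \<Rightarrow> nat) \<Rightarrow> 'a \<Rightarrow> 'a"
  unt :: "int \<Rightarrow> 'a"
  ext :: "part \<Rightarrow> part \<Rightarrow> 'a \<Rightarrow> 'a \<Rightarrow> 'a"

locale partition_functor =
  fixes M :: "'a pfunctor"
  assumes val_group: "is_partition \<Lambda> \<Longrightarrow> abelian_group (val M \<Lambda>)"
    and res_hom: "morphism \<Lambda> \<Omega> f \<Longrightarrow>
      res M \<Lambda> \<Omega> f \<in> hom (add_monoid (val M \<Omega>)) (add_monoid (val M \<Lambda>))"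
    and tr_hom: "morphism \<Lambda> \<Omega> f \<Longrightarrow>
      tr M \<Lambda> \<Omega> f \<in> hom (add_monoid (val M \<Lambda>)) (add_monoid (val M \<Omega>))"
    and res_id: "\<lbrakk>is_partition \<Lambda>; x \<in> carrier (val M \<Lambda>)\<rbrakk> \<Longrightarrow> res M \<Lambda> \<Lambda> id x = x"
    and tr_id: "\<lbrakk>is_partition \<Lambda>; x \<in> carrier (val M \<Lambda>)\<rbrakk> \<Longrightarrow> tr M \<Lambda> \<Lambda> id x = x"
    and res_comp: "\<lbrakk>morphism \<Lambda> \<Omega> f; morphism \<Omega> \<Theta> g; x \<in> carrier (val M \<Theta>)\<rbrakk> \<Longrightarrow>
      res M \<Lambda> \<Theta> (g \<circ> f) x = res M \<Lambda> \<Omega> f (res M \<Omega> \<Theta> g x)"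
    and tr_comp: "\<lbrakk>morphism \<Lambda> \<Omega> f; morphism \<Omega> \<Theta> g; x \<in> carrier (val M \<Lambda>)\<rbrakk> \<Longrightarrow>
      tr M \<Lambda> \<Theta> (g \<circ> f) x = tr M \<Omega> \<Theta> g (tr M \<Lambda> \<Omega> f x)"
    and res_two_iso: "\<lbrakk>morphism \<Lambda> \<Omega> f; morphism \<Lambda> \<Omega> g; two_iso \<Lambda> \<Omega> f g;
      x \<in> carrier (val M \<Omega>)\<rbrakk> \<Longrightarrow> res M \<Lambda> \<Omega> f x = res M \<Lambda> \<Omega> g x"
    and tr_two_iso: "\<lbrakk>morphism \<Lambda> \<Omega> f; morphism \<Lambda> \<Omega> g; two_iso \<Lambda> \<Omega> f g;
      x \<in> carrier (val M \<Lambda>)\<rbrakk> \<Longrightarrow> tr M \<Lambda> \<Omega> f x = tr M \<Lambda> \<Omega> g x"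
    and tr_iso: "\<lbrakk>isomorphism \<Lambda> \<Omega> f; x \<in> carrier (val M \<Lambda>)\<rbrakk> \<Longrightarrow>
      tr M \<Lambda> \<Omega> f x = res M \<Omega> \<Lambda> (inv_into (pts \<Lambda>) f) x"
    and double_coset: "\<lbrakk>\<Gamma> \<preceq> \<Omega>; \<Lambda> \<preceq> \<Omega>; x \<in> carrier (val M \<Lambda>)\<rbrakk> \<Longrightarrow>
      res M \<Gamma> \<Omega> id (tr M \<Lambda> \<Omega> id x) =
      (\<Oplus>\<^bsub>val M \<Gamma>\<^esub>D\<in>dcosets \<Gamma> \<Omega> \<Lambda>.
         let \<sigma> = drep D;
           \<Lambda>1 = common_refinement (transport (inv_into UNIV \<sigma>) \<Gamma>) \<Lambda>;
           \<Gamma>1 = common_refinement \<Gamma> (transport \<sigma> \<Lambda>)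
         in tr M \<Gamma>1 \<Gamma> id (tr M \<Lambda>1 \<Gamma>1 \<sigma> (res M \<Lambda>1 \<Lambda> id x)))"

locale lax_partition_functor = partition_functor +
  assumes unt_hom: "unt M 0 = \<zero>\<^bsub>val M (std 0)\<^esub>"
      "unt M n \<in> carrier (val M (std 0))"
      "unt M (n + n') = unt M n \<oplus>\<^bsub>val M (std 0)\<^esub> unt M n'"
    and ext_hom_left: "\<lbrakk>is_partition \<Lambda>; is_partition \<Omega>; y \<in> carrier (val M \<Omega>)\<rbrakk> \<Longrightarrow>
      (\<lambda>x. ext M \<Lambda> \<Omega> x y) \<in> hom (add_monoid (val M \<Lambda>)) (add_monoid (val M (\<Lambda> \<uplus> \<Omega>)))"
    and ext_hom_right: "\<lbrakk>is_partition \<Lambda>; is_partition \<Omega>; x \<in> carrier (val M \<Lambda>)\<rbrakk> \<Longrightarrow>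
      (\<lambda>y. ext M \<Lambda> \<Omega> x y) \<in> hom (add_monoid (val M \<Omega>)) (add_monoid (val M (\<Lambda> \<uplus> \<Omega>)))"
    and ext_res: "\<lbrakk>morphism \<Lambda> \<Lambda>' f; morphism \<Omega> \<Omega>' g;
      x \<in> carrier (val M \<Lambda>'); y \<in> carrier (val M \<Omega>')\<rbrakk> \<Longrightarrow>
      res M (\<Lambda> \<uplus> \<Omega>) (\<Lambda>' \<uplus> \<Omega>') (dsum_map f g) (ext M \<Lambda>' \<Omega>' x y) =
      ext M \<Lambda> \<Omega> (res M \<Lambda> \<Lambda>' f x) (res M \<Omega> \<Omega>' g y)"
    and ext_tr: "\<lbrakk>morphism \<Lambda> \<Lambda>' f; morphism \<Omega> \<Omega>' g;
      x \<in> carrier (val M \<Lambda>); y \<in> carrier (val M \<Omega>)\<rbrakk> \<Longrightarrow>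
      tr M (\<Lambda> \<uplus> \<Omega>) (\<Lambda>' \<uplus> \<Omega>') (dsum_map f g) (ext M \<Lambda> \<Omega> x y) =
      ext M \<Lambda>' \<Omega>' (tr M \<Lambda> \<Lambda>' f x) (tr M \<Omega> \<Omega>' g y)"
    and ext_assoc: "\<lbrakk>is_partition \<Lambda>; is_partition \<Omega>; is_partition \<Theta>;
      x \<in> carrier (val M \<Lambda>); y \<in> carrier (val M \<Omega>); z \<in> carrier (val M \<Theta>)\<rbrakk> \<Longrightarrow>
      tr M ((\<Lambda> \<uplus> \<Omega>) \<uplus> \<Theta>) (\<Lambda> \<uplus> (\<Omega> \<uplus> \<Theta>)) dsum_assoc
        (ext M (\<Lambda> \<uplus> \<Omega>) \<Theta> (ext M \<Lambda> \<Omega> x y) z) =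
      ext M \<Lambda> (\<Omega> \<uplus> \<Theta>) x (ext M \<Omega> \<Theta> y z)"
    and ext_unit_left: "\<lbrakk>is_partition \<Lambda>; x \<in> carrier (val M \<Lambda>)\<rbrakk> \<Longrightarrow>
      tr M (std 0 \<uplus> \<Lambda>) \<Lambda> untag (ext M (std 0) \<Lambda> (unt M 1) x) = x"
    and ext_unit_right: "\<lbrakk>is_partition \<Lambda>; x \<in> carrier (val M \<Lambda>)\<rbrakk> \<Longrightarrow>
      tr M (\<Lambda> \<uplus> std 0) \<Lambda> untag (ext M \<Lambda> (std 0) x (unt M 1)) = x"
    and ext_swap: "\<lbrakk>is_partition \<Lambda>; is_partition \<Omega>;
      x \<in> carrier (val M \<Lambda>); y \<in> carrier (val M \<Omega>)\<rbrakk> \<Longrightarrow>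
      tr M (\<Lambda> \<uplus> \<Omega>) (\<Omega> \<uplus> \<Lambda>) dsum_swap (ext M \<Lambda> \<Omega> x y) = ext M \<Omega> \<Lambda> y x"

locale partition_ring = lax_partition_functor R for R :: "'a pfunctor" +
  assumes val_cring: "is_partition \<Lambda> \<Longrightarrow> cring (val R \<Lambda>)"
    and res_ring_hom: "morphism \<Lambda> \<Omega> f \<Longrightarrow>
      res R \<Lambda> \<Omega> f \<in> ring_hom (val R \<Omega>) (val R \<Lambda>)"
    and ext_one: "\<lbrakk>is_partition \<Lambda>; is_partition \<Omega>\<rbrakk> \<Longrightarrow>
      ext R \<Lambda> \<Omega> \<one>\<^bsub>val R \<Lambda>\<^esub> \<one>\<^bsub>val R \<Omega>\<^esub> = \<one>\<^bsub>val R (\<Lambda> \<uplus> \<Omega>)\<^esub>"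
    and ext_mult: "\<lbrakk>is_partition \<Lambda>; is_partition \<Omega>;
      x \<in> carrier (val R \<Lambda>); x' \<in> carrier (val R \<Lambda>);
      y \<in> carrier (val R \<Omega>); y' \<in> carrier (val R \<Omega>)\<rbrakk> \<Longrightarrow>
      ext R \<Lambda> \<Omega> (x \<otimes>\<^bsub>val R \<Lambda>\<^esub> x') (y \<otimes>\<^bsub>val R \<Omega>\<^esub> y') =
      ext R \<Lambda> \<Omega> x y \<otimes>\<^bsub>val R (\<Lambda> \<uplus> \<Omega>)\<^esub> ext R \<Lambda> \<Omega> x' y'"
    and frobenius: "\<lbrakk>morphism \<Lambda> \<Omega> f; a \<in> carrier (val R \<Omega>); b \<in> carrier (val R \<Lambda>)\<rbrakk> \<Longrightarrow>
      tr R \<Lambda> \<Omega> f (res R \<Lambda> \<Omega> f a \<otimes>\<^bsub>val R \<Lambda>\<^esub> b) =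
      a \<otimes>\<^bsub>val R \<Omega>\<^esub> tr R \<Lambda> \<Omega> f b"


section \<open>The ring of symmetric functions\<close>

definition transfer_prod :: "'a pfunctor \<Rightarrow> nat \<Rightarrow> nat \<Rightarrow> 'a \<Rightarrow> 'a \<Rightarrow> 'a" where
  "transfer_prod M i j x y =
     tr M (std i \<uplus> std j) (std (i + j)) (concat_map i) (ext M (std i) (std j) x y)"

text \<open>The series \<open>\<Sum>\<^sub>m r\<^sub>m t\<^sup>m\<close> is the function \<open>r\<close>.\<close>

definition series :: "'a pfunctor \<Rightarrow> (nat \<Rightarrow> 'a) ring" where
  "series M = \<lparr>
     carrier = {r. \<forall>m. r m \<in> carrier (val M (std m))},
     monoid.mult = (\<lambda>r s m. \<Oplus>\<^bsub>val M (std m)\<^esub>i\<in>{..m}. transfer_prod M i (m - i) (r i) (s (m - i))),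
     one = (\<lambda>m. if m = 0 then unt M 1 else \<zero>\<^bsub>val M (std m)\<^esub>),
     zero = (\<lambda>m. \<zero>\<^bsub>val M (std m)\<^esub>),
     add = (\<lambda>r s m. r m \<oplus>\<^bsub>val M (std m)\<^esub> s m)\<rparr>"

definition exponential :: "'a pfunctor \<Rightarrow> (nat \<Rightarrow> 'a) \<Rightarrow> bool" where
  "exponential M r \<longleftrightarrow> r \<in> carrier (series M) \<and> r 0 = unt M 1 \<and>
     (\<forall>i j. res M (std i \<uplus> std j) (std (i + j)) (concat_map i) (r (i + j)) =
            ext M (std i) (std j) (r i) (r j))"


section \<open>The partition ring PD(R)\<close>

definition tr_ideal :: "'a pfunctor \<Rightarrow> part \<Rightarrow> 'a set" where
  "tr_ideal R \<Gamma> = {(\<Oplus>\<^bsub>val R \<Gamma>\<^esub>\<Omega>\<in>{\<Omega>. \<Omega> \<prec> \<Gamma>}. tr R \<Omega> \<Gamma> id (a \<Omega>)) | a.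
     \<forall>\<Omega>. \<Omega> \<prec> \<Gamma> \<longrightarrow> a \<Omega> \<in> carrier (val R \<Omega>)}"

definition bar :: "'a pfunctor \<Rightarrow> part \<Rightarrow> 'a set ring" where
  "bar R \<Gamma> = val R \<Gamma> Quot tr_ideal R \<Gamma>"

definition bar_proj :: "'a pfunctor \<Rightarrow> part \<Rightarrow> 'a \<Rightarrow> 'a set" where
  "bar_proj R \<Gamma> z = tr_ideal R \<Gamma> +>\<^bsub>val R \<Gamma>\<^esub> z"

text \<open>Only used along isomorphisms, whose transfers map cosets onto cosets.\<close>

definition bar_tr :: "'a pfunctor \<Rightarrow> part \<Rightarrow> part \<Rightarrow> (nat \<Rightarrow> nat) \<Rightarrow> 'a set \<Rightarrow> 'a set" where
  "bar_tr R \<Lambda> \<Omega> f S = tr R \<Lambda> \<Omega> f ` S"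

definition bar_ext :: "'a pfunctor \<Rightarrow> part \<Rightarrow> part \<Rightarrow> 'a set \<Rightarrow> 'a set \<Rightarrow> 'a set" where
  "bar_ext R \<Lambda> \<Omega> S T = (\<Union>s\<in>S. \<Union>t\<in>T. bar_proj R (\<Lambda> \<uplus> \<Omega>) (ext R \<Lambda> \<Omega> s t))"

text \<open>Elements of \<open>\<Oplus>\<^sub>\<Gamma>\<^sub>\<preceq>\<^sub>\<Lambda> bar R \<Gamma>\<close> are functions that are \<^const>\<open>undefined\<close>
  outside \<open>{\<Gamma>. \<Gamma> \<preceq> \<Lambda>}\<close>.\<close>

definition PD_act ::
  "'a pfunctor \<Rightarrow> part \<Rightarrow> (nat \<Rightarrow> nat) \<Rightarrow> (part \<Rightarrow> 'a set) \<Rightarrow> part \<Rightarrow> 'a set" where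
  "PD_act R \<Lambda> \<sigma> x = (\<lambda>\<Gamma>\<in>{\<Gamma>. \<Gamma> \<preceq> \<Lambda>}.
     bar_tr R (transport (inv_into UNIV \<sigma>) \<Gamma>) \<Gamma> \<sigma> (x (transport (inv_into UNIV \<sigma>) \<Gamma>)))"

definition PD_val :: "'a pfunctor \<Rightarrow> part \<Rightarrow> (part \<Rightarrow> 'a set) ring" where
  "PD_val R \<Lambda> = \<lparr>
     carrier = {x \<in> (\<Pi>\<^sub>E \<Gamma>\<in>{\<Gamma>. \<Gamma> \<preceq> \<Lambda>}. carrier (bar R \<Gamma>)). \<forall>\<sigma>\<in>Sym \<Lambda>. PD_act R \<Lambda> \<sigma> x = x},
     monoid.mult = (\<lambda>x y. \<lambda>\<Gamma>\<in>{\<Gamma>. \<Gamma> \<preceq> \<Lambda>}. x \<Gamma> \<otimes>\<^bsub>bar R \<Gamma>\<^esub> y \<Gamma>),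
     one = (\<lambda>\<Gamma>\<in>{\<Gamma>. \<Gamma> \<preceq> \<Lambda>}. \<one>\<^bsub>bar R \<Gamma>\<^esub>),
     zero = (\<lambda>\<Gamma>\<in>{\<Gamma>. \<Gamma> \<preceq> \<Lambda>}. \<zero>\<^bsub>bar R \<Gamma>\<^esub>),
     add = (\<lambda>x y. \<lambda>\<Gamma>\<in>{\<Gamma>. \<Gamma> \<preceq> \<Lambda>}. x \<Gamma> \<oplus>\<^bsub>bar R \<Gamma>\<^esub> y \<Gamma>)\<rparr>"

definition PD_res ::
  "'a pfunctor \<Rightarrow> part \<Rightarrow> part \<Rightarrow> (nat \<Rightarrow> nat) \<Rightarrow> (part \<Rightarrow> 'a set) \<Rightarrow> part \<Rightarrow> 'a set" where
  "PD_res R \<Lambda> \<Omega> f x = (\<lambda>\<Gamma>\<in>{\<Gamma>. \<Gamma> \<preceq> \<Lambda>}.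
     inv_into (carrier (bar R \<Gamma>)) (bar_tr R \<Gamma> (transport f \<Gamma>) f) (x (transport f \<Gamma>)))"

definition PD_tr ::
  "'a pfunctor \<Rightarrow> part \<Rightarrow> part \<Rightarrow> (nat \<Rightarrow> nat) \<Rightarrow> (part \<Rightarrow> 'a set) \<Rightarrow> part \<Rightarrow> 'a set" where
  "PD_tr R \<Psi> \<Lambda> f x = (\<lambda>\<Gamma>\<in>{\<Gamma>. \<Gamma> \<preceq> \<Lambda>}.
     \<Oplus>\<^bsub>bar R \<Gamma>\<^esub>D\<in>{D \<in> dcosets \<Gamma> \<Lambda> (transport f \<Psi>). \<Gamma> \<preceq> transport (drep D) (transport f \<Psi>)}.
       let g = drep D \<circ> f; \<Gamma>1 = transport (inv_into (pts \<Psi>) g) \<Gamma>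
       in bar_tr R \<Gamma>1 \<Gamma> g (x \<Gamma>1))"

definition PD_ext ::
  "'a pfunctor \<Rightarrow> part \<Rightarrow> part \<Rightarrow> (part \<Rightarrow> 'a set) \<Rightarrow> (part \<Rightarrow> 'a set) \<Rightarrow> part \<Rightarrow> 'a set" where
  "PD_ext R \<Lambda> \<Omega> x y = (\<lambda>\<Xi>\<in>{\<Xi>. \<Xi> \<preceq> \<Lambda> \<uplus> \<Omega>}.
     bar_ext R (left_part \<Xi>) (right_part \<Xi>) (x (left_part \<Xi>)) (y (right_part \<Xi>)))"

definition eta :: "'a pfunctor \<Rightarrow> part \<Rightarrow> 'a \<Rightarrow> part \<Rightarrow> 'a set" where
  "eta R \<Lambda> z = (\<lambda>\<Gamma>\<in>{\<Gamma>. \<Gamma> \<preceq> \<Lambda>}. bar_proj R \<Gamma> (res R \<Gamma> \<Lambda> id z))"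

definition PD :: "'a pfunctor \<Rightarrow> (part \<Rightarrow> 'a set) pfunctor" where
  "PD R = \<lparr>val = PD_val R, res = PD_res R, tr = PD_tr R,
     unt = (\<lambda>n. eta R (std 0) (unt R n)), ext = PD_ext R\<rparr>"

text \<open>The inclusion of the summand \<open>bar R (std m)\<close> in \<open>PD_val R (std m)\<close>.\<close>

definition top_incl :: "'a pfunctor \<Rightarrow> nat \<Rightarrow> 'a set \<Rightarrow> part \<Rightarrow> 'a set" where
  "top_incl R m y = (\<lambda>\<Gamma>\<in>{\<Gamma>. \<Gamma> \<preceq> std m}. if \<Gamma> = std m then y else \<zero>\<^bsub>bar R \<Gamma>\<^esub>)"

definition top_one :: "'a pfunctor \<Rightarrow> nat \<Rightarrow> part \<Rightarrow> 'a set" where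
  "top_one R m = top_incl R m \<one>\<^bsub>bar R (std m)\<^esub>"


section \<open>The integral exponential\<close>

text \<open>The result does not depend on the chosen bijection, as any two are 2-isomorphic.\<close>

definition to_block :: "'a pfunctor \<Rightarrow> nat set \<Rightarrow> 'a set \<Rightarrow> 'a set" where
  "to_block R B y =
     bar_tr R (std (card B)) (indisc B) (SOME f. bij_betw f {1..card B} B) y"

definition of_blocks :: "nat set set \<Rightarrow> part" where
  "of_blocks \<B> = Part (\<Union>\<B>) (\<Union>B\<in>\<B>. B \<times> B)"

text \<open>The external product of the \<open>y\<^bsub>|B|\<^esub>\<close> over a list of disjoint blocks, moved to the
  partition with these blocks. By associativity and symmetry the order of the blocks is
  irrelevant.\<close>

fun block_prod_list :: "'a pfunctor \<Rightarrow> (nat \<Rightarrow> 'a set) \<Rightarrow> nat set list \<Rightarrow> 'a set" where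
  "block_prod_list R y [] = bar_proj R (std 0) (unt R 1)"
| "block_prod_list R y (B # Bs) =
     bar_tr R (indisc B \<uplus> of_blocks (set Bs)) (of_blocks (set (B # Bs))) untag
       (bar_ext R (indisc B) (of_blocks (set Bs))
          (to_block R B (y (card B))) (block_prod_list R y Bs))"

definition block_prod :: "'a pfunctor \<Rightarrow> (nat \<Rightarrow> 'a set) \<Rightarrow> part \<Rightarrow> 'a set" where
  "block_prod R y \<Gamma> = block_prod_list R y (SOME Bs. distinct Bs \<and> set Bs = blocks \<Gamma>)"

text \<open>Sequences \<open>\<lambda>\<^sub>1, \<lambda>\<^sub>2, \<dots>\<close> with \<open>\<Sum>\<^sub>i i \<lambda>\<^sub>i = m\<close>;
  the unused entry at index 0 is fixed to be 0.\<close>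

definition exponents :: "nat \<Rightarrow> (nat \<Rightarrow> nat) set" where
  "exponents m = {l. l 0 = 0 \<and> finite {i. l i \<noteq> 0} \<and> (\<Sum>i | l i \<noteq> 0. i * l i) = m}"

text \<open>The element \<open>1/\<lambda>! \<Prod>\<^sub>i x\<^sub>i\<^bsup>\<lambda>\<^sub>i\<^esup>\<close> of \<open>PD_val R (std m)\<close>, where \<open>x\<^sub>i\<close> lies in
  the summand \<open>bar R (std i)\<close> of \<open>PD_val R (std i)\<close>; as an element of \<open>bar R (std i)\<close> it is its own
  component at \<open>std i\<close>. It is the canonical quotient by \<open>\<lambda>!\<close> of the product of powers in
  \<^term>\<open>series (PD R)\<close>.\<close>

definition divided_monomial ::
  "'a pfunctor \<Rightarrow> nat \<Rightarrow> (nat \<Rightarrow> part \<Rightarrow> 'a set) \<Rightarrow> (nat \<Rightarrow> nat) \<Rightarrow> part \<Rightarrow> 'a set" where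
  "divided_monomial R m x l = (\<lambda>\<Gamma>\<in>{\<Gamma>. \<Gamma> \<preceq> std m}.
     if \<forall>i. card {B \<in> blocks \<Gamma>. card B = i} = l i
     then block_prod R (\<lambda>i. x i (std i)) \<Gamma> else \<zero>\<^bsub>bar R \<Gamma>\<^esub>)"

text \<open>The exponential of \<open>\<Sum>\<^sub>i x\<^sub>i t\<^sup>i\<close> over \<open>i \<ge> 1\<close>, where
  \<open>x\<^sub>i \<in> bar R (std i)\<close>; it does not involve \<open>x\<^sub>0\<close>.\<close>

definition PD_exp :: "'a pfunctor \<Rightarrow> (nat \<Rightarrow> part \<Rightarrow> 'a set) \<Rightarrow> nat \<Rightarrow> part \<Rightarrow> 'a set" where
  "PD_exp R x m = (\<Oplus>\<^bsub>val (PD R) (std m)\<^esub>l\<in>exponents m. divided_monomial R m x l)"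

end

theory Submission
  imports Defs
begin

text \<open>
  Both sides are compared in each component \<open>\<Gamma> \<preceq> std m\<close>. The block sizes of \<open>\<Gamma>\<close>
  single out one exponent sequence, so the component of the exponential at \<open>\<Gamma>\<close> is the single
  external product of the classes of \<open>r\<^bsub>card B\<^esub>\<close> over the blocks \<open>B\<close> of \<open>\<Gamma>\<close>.
  By induction over the blocks, exponentiality turns this external product into the restriction of \<open>r\<^sub>m\<close> along
  \<open>\<Gamma> \<preceq> std m\<close>; the chosen bijections are irrelevant because any two morphisms into an indiscrete
  partition are 2-isomorphic.
\<close>

section \<open>Morphisms of partitions\<close>

text \<open>The exponential is a \<open>finsum\<close> in \<open>PD_val\<close>, and such a sum can
  be split term by term only when its summands lie in the carrier, that is, are invariant under
  \<open>Sym (std m)\<close>. Invariance is awkward to check on the chosen block lists and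
  bijections behind \<open>block_prod\<close>. It becomes easy once the external product is known to
  be a component of \<open>eta\<close>: each divided monomial is then the image of
  \<open>r m\<close> under \<open>eta\<close> with all components outside one block type replaced by
  zero, so it suffices that \<open>eta\<close> takes invariant values and that block types do not
  change under transport. The components are cosets of the transfer ideal, while exponentiality
  speaks about elements of \<open>R\<close>. Transfers along isomorphisms and external products
  respect this ideal, since a transfer from a strictly finer partition turns into another such
  transfer. Hence the operations on cosets can be computed on representatives, where functoriality,
  invariance under 2-isomorphisms and exponentiality apply.\<close>

lemma is_partition_indisc: "finite B \<Longrightarrow> is_partition (indisc B)"
  by (auto simp: is_partition_def indisc_def equiv_def refl_on_def sym_def trans_def)

lemma is_partition_std: "is_partition (std m)"
  by (simp add: std_def is_partition_indisc)

lemma pts_std [simp]: "pts (std m) = {1..m}"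
  by (simp add: std_def indisc_def)

lemma pts_indisc [simp]: "pts (indisc B) = B"
  by (simp add: indisc_def)

lemma rel_in_pts:
  "is_partition \<Lambda> \<Longrightarrow> (x, y) \<in> rel \<Lambda> \<Longrightarrow> x \<in> pts \<Lambda> \<and> y \<in> pts \<Lambda>"
  unfolding is_partition_def by (auto dest: equiv_type)

lemma is_partition_refl: "is_partition \<Lambda> \<Longrightarrow> x \<in> pts \<Lambda> \<Longrightarrow> (x, x) \<in> rel \<Lambda>"
  unfolding is_partition_def by (auto elim: equivE dest: refl_onD)

lemma is_partition_sym: "is_partition \<Lambda> \<Longrightarrow> (x, y) \<in> rel \<Lambda> \<Longrightarrow> (y, x) \<in> rel \<Lambda>"
  unfolding is_partition_def by (auto elim!: equivE dest: symD)

lemma is_partition_trans: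
  "is_partition \<Lambda> \<Longrightarrow> (x, y) \<in> rel \<Lambda> \<Longrightarrow> (y, z) \<in> rel \<Lambda> \<Longrightarrow> (x, z) \<in> rel \<Lambda>"
  unfolding is_partition_def by (blast elim: equivE dest: transD)

lemma is_partitionI:
  assumes "finite (pts \<Lambda>)" and "rel \<Lambda> \<subseteq> pts \<Lambda> \<times> pts \<Lambda>"
    and "\<And>x. x \<in> pts \<Lambda> \<Longrightarrow> (x, x) \<in> rel \<Lambda>"
    and "\<And>x y. (x, y) \<in> rel \<Lambda> \<Longrightarrow> (y, x) \<in> rel \<Lambda>"
    and "\<And>x y z. (x, y) \<in> rel \<Lambda> \<Longrightarrow> (y, z) \<in> rel \<Lambda> \<Longrightarrow> (x, z) \<in> rel \<Lambda>"
  shows "is_partition \<Lambda>"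
  using assms unfolding is_partition_def equiv_def refl_on_def sym_def trans_def by blast

lemma refines_le_iff:
  "\<Gamma> \<preceq> \<Lambda> \<longleftrightarrow> is_partition \<Gamma> \<and> is_partition \<Lambda> \<and> pts \<Gamma> = pts \<Lambda> \<and> rel \<Gamma> \<subseteq> rel \<Lambda>"
  by (auto simp: refines_le_def morphism_def)

lemma refines_less_iff:
  "\<Gamma> \<prec> \<Lambda> \<longleftrightarrow> is_partition \<Gamma> \<and> is_partition \<Lambda> \<and> pts \<Gamma> = pts \<Lambda> \<and> rel \<Gamma> \<subset> rel \<Lambda>"
  by (cases \<Gamma>; cases \<Lambda>) (auto simp: refines_less_def refines_le_iff)

lemma refines_le_morphism: "\<Gamma> \<preceq> \<Lambda> \<Longrightarrow> morphism \<Gamma> \<Lambda> id"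
  by (simp add: refines_le_def)

text \<open>A \<open>finsum\<close> over an infinite index set is zero by convention; finiteness
  makes \<open>tr_ideal\<close> a genuine sum of images.\<close>

lemma finite_refines_less: "finite {\<Omega>. \<Omega> \<prec> \<Gamma>}"
proof (cases "is_partition \<Gamma>")
  case True
  have "\<Omega> \<in> Part (pts \<Gamma>) ` Pow (rel \<Gamma>)" if "\<Omega> \<prec> \<Gamma>" for \<Omega>
    using that by (cases \<Omega>) (auto simp: refines_less_iff)
  moreover have "finite (rel \<Gamma>)"
    using True rel_in_pts[OF True]
    by (intro finite_subset[of "rel \<Gamma>" "pts \<Gamma> \<times> pts \<Gamma>"]) (auto simp: is_partition_def)
  ultimately show ?thesis
    by (intro finite_subset[of "{\<Omega>. \<Omega> \<prec> \<Gamma>}" "Part (pts \<Gamma>) ` Pow (rel \<Gamma>)"]) auto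
qed (simp add: refines_less_iff)

lemma morphism_std:
  "is_partition \<Lambda> \<Longrightarrow> bij_betw f (pts \<Lambda>) {1..n} \<Longrightarrow> morphism \<Lambda> (std n) f"
  unfolding morphism_def using is_partition_std[of n] rel_in_pts[of \<Lambda>]
  by (fastforce simp: std_def indisc_def simp del: One_nat_def dest: bij_betwE)

lemma morphism_comp:
  "morphism \<Lambda> \<Omega> f \<Longrightarrow> morphism \<Omega> \<Theta> g \<Longrightarrow> morphism \<Lambda> \<Theta> (g \<circ> f)"
  unfolding morphism_def by (auto intro: bij_betw_trans)

text \<open>Used to replace a map such as \<open>f \<circ> inv_into (pts \<Lambda>) f\<close> by
  \<open>id\<close> although the two may differ away from the points.\<close>

lemma two_iso_eq_on:
  "is_partition \<Omega> \<Longrightarrow> (\<And>x. x \<in> pts \<Lambda> \<Longrightarrow> f x = g x \<and> g x \<in> pts \<Omega>) \<Longrightarrow> two_iso \<Lambda> \<Omega> f g"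
  by (auto simp: two_iso_def intro: is_partition_refl)

lemma two_iso_std:
  "bij_betw f (pts \<Lambda>) {1..n} \<Longrightarrow> bij_betw g (pts \<Lambda>) {1..n} \<Longrightarrow> two_iso \<Lambda> (std n) f g"
  by (auto simp: two_iso_def std_def indisc_def dest: bij_betwE)

text \<open>Trades the inverse map for the requirement that \<open>f\<close> reflects the relation,
  which is easier to check and to apply.\<close>

lemma isomorphism_iff:
  "isomorphism \<Lambda> \<Omega> f \<longleftrightarrow> is_partition \<Lambda> \<and> is_partition \<Omega> \<and> bij_betw f (pts \<Lambda>) (pts \<Omega>) \<and>
     (\<forall>x\<in>pts \<Lambda>. \<forall>y\<in>pts \<Lambda>. (x, y) \<in> rel \<Lambda> \<longleftrightarrow> (f x, f y) \<in> rel \<Omega>)"  (is "?L \<longleftrightarrow> ?R")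
proof
  assume L: ?L
  then have b: "bij_betw f (pts \<Lambda>) (pts \<Omega>)" by (simp add: isomorphism_def morphism_def)
  have "(x, y) \<in> rel \<Lambda>" if "x \<in> pts \<Lambda>" "y \<in> pts \<Lambda>" "(f x, f y) \<in> rel \<Omega>" for x y
    using L that b unfolding isomorphism_def morphism_def
    by (metis bij_betw_inv_into_left)
  then show ?R using L by (auto simp: isomorphism_def morphism_def)
next
  assume R: ?R
  then have b: "bij_betw f (pts \<Lambda>) (pts \<Omega>)" by simp
  have "(inv_into (pts \<Lambda>) f x, inv_into (pts \<Lambda>) f y) \<in> rel \<Lambda>" if "(x, y) \<in> rel \<Omega>" for x y
    using R that rel_in_pts[of \<Omega> x y] bij_betw_inv_into_right[OF b] bij_betwE[OF bij_betw_inv_into[OF b]]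
    by metis
  then show ?L using R bij_betw_inv_into[OF b] rel_in_pts
    unfolding isomorphism_def morphism_def by blast
qed

lemma isomorphism_morphism: "isomorphism \<Lambda> \<Omega> f \<Longrightarrow> morphism \<Lambda> \<Omega> f"
  by (simp add: isomorphism_def)

lemma isomorphism_inv:
  assumes "isomorphism \<Lambda> \<Omega> f"
  shows "isomorphism \<Omega> \<Lambda> (inv_into (pts \<Lambda>) f)"
proof -
  have b: "bij_betw f (pts \<Lambda>) (pts \<Omega>)"
    using assms by (simp add: isomorphism_iff)
  note [simp] = bij_betw_inv_into_right[OF b]
  have "inv_into (pts \<Lambda>) f x \<in> pts \<Lambda>" if "x \<in> pts \<Omega>" for x
    using that bij_betwE[OF bij_betw_inv_into[OF b]] by blast
  then show ?thesis
    using assms bij_betw_inv_into[OF b] by (auto simp: isomorphism_iff)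
qed

section \<open>Transport of partitions along injective maps\<close>

lemma is_partition_transport:
  assumes "is_partition \<Gamma>" "inj_on f (pts \<Gamma>)"
  shows "is_partition (transport f \<Gamma>)"
proof (rule is_partitionI)
  fix x y z
  assume "(x, y) \<in> rel (transport f \<Gamma>)" "(y, z) \<in> rel (transport f \<Gamma>)"
  then obtain a b b' c where h: "x = f a" "y = f b" "(a, b) \<in> rel \<Gamma>"
      "y = f b'" "z = f c" "(b', c) \<in> rel \<Gamma>"
    by (fastforce simp: transport_def)
  \<comment> \<open>Transitivity rests on injectivity: the two preimages of the middle point must
    coincide before the related pairs can be chained.\<close>
  then have "b = b'" using assms by (meson inj_onD rel_in_pts)
  then show "(x, z) \<in> rel (transport f \<Gamma>)"
    using h is_partition_trans[OF assms(1)] by (force simp: transport_def)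
next
  show "rel (transport f \<Gamma>) \<subseteq> pts (transport f \<Gamma>) \<times> pts (transport f \<Gamma>)"
    using rel_in_pts[OF assms(1)] by (force simp: transport_def)
next
  fix x assume "x \<in> pts (transport f \<Gamma>)"
  then show "(x, x) \<in> rel (transport f \<Gamma>)"
    using is_partition_refl[OF assms(1)] by (force simp: transport_def)
next
  fix x y assume "(x, y) \<in> rel (transport f \<Gamma>)"
  then show "(y, x) \<in> rel (transport f \<Gamma>)"
    using is_partition_sym[OF assms(1)] by (force simp: transport_def)
qed (use assms in \<open>simp add: transport_def is_partition_def\<close>)

lemma isomorphism_transport:
  assumes "is_partition \<Gamma>" "inj_on f (pts \<Gamma>)"
  shows "isomorphism \<Gamma> (transport f \<Gamma>) f"
proof -
  have "(x, y) \<in> rel \<Gamma>" if h: "x \<in> pts \<Gamma>" "y \<in> pts \<Gamma>" "(f x, f y) \<in> rel (transport f \<Gamma>)" for x y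
  proof -
    obtain a b where "f x = f a" "f y = f b" "(a, b) \<in> rel \<Gamma>"
      using h by (auto simp: transport_def)
    then show ?thesis using assms h by (metis inj_onD rel_in_pts)
  qed
  then show ?thesis
    using assms is_partition_transport[OF assms]
    by (force simp: isomorphism_iff transport_def bij_betw_def)
qed

lemma transport_refines:
  assumes "\<Gamma> \<preceq> \<Lambda>" "isomorphism \<Lambda> \<Omega> f"
  shows "transport f \<Gamma> \<preceq> \<Omega>"
  unfolding refines_le_iff
proof (intro conjI)
  have b: "bij_betw f (pts \<Lambda>) (pts \<Omega>)" using assms by (simp add: isomorphism_iff)
  have p: "is_partition \<Gamma>" "pts \<Gamma> = pts \<Lambda>" using assms by (auto simp: refines_le_iff)
  show "is_partition (transport f \<Gamma>)"
    using p b by (simp add: is_partition_transport bij_betw_def)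
  show "is_partition \<Omega>" using assms by (simp add: isomorphism_iff)
  show "pts (transport f \<Gamma>) = pts \<Omega>"
    using p b by (simp add: transport_def bij_betw_def)
  show "rel (transport f \<Gamma>) \<subseteq> rel \<Omega>"
  proof
    fix p assume "p \<in> rel (transport f \<Gamma>)"
    then obtain x y where "p = (f x, f y)" "(x, y) \<in> rel \<Gamma>"
      by (auto simp: transport_def)
    then show "p \<in> rel \<Omega>"
      using assms rel_in_pts[of \<Gamma> x y] by (auto simp: refines_le_iff isomorphism_iff)
  qed
qed

text \<open>Strictness survives because an isomorphism reflects the relation: a pair separated by
  \<Gamma> but not by \<Lambda> is carried to a pair of the same kind.\<close>

lemma transport_refines_less:
  assumes "\<Gamma> \<prec> \<Lambda>" "isomorphism \<Lambda> \<Omega> f"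
  shows "transport f \<Gamma> \<prec> \<Omega>"
proof -
  have le: "\<Gamma> \<preceq> \<Lambda>" and ne: "rel \<Gamma> \<subset> rel \<Lambda>"
    using assms(1) refines_less_iff[of \<Gamma> \<Lambda>] by (auto simp: refines_less_def)
  have p: "is_partition \<Gamma>" "pts \<Gamma> = pts \<Lambda>" "is_partition \<Lambda>" using le by (auto simp: refines_le_iff)
  obtain x y where xy: "(x, y) \<in> rel \<Lambda>" "(x, y) \<notin> rel \<Gamma>" using ne by auto
  then have "x \<in> pts \<Lambda>" "y \<in> pts \<Lambda>" using rel_in_pts p by blast+
  moreover have "isomorphism \<Gamma> (transport f \<Gamma>) f"
    using assms(2) p by (intro isomorphism_transport) (simp_all add: isomorphism_iff bij_betw_def)
  ultimately have "(f x, f y) \<in> rel \<Omega>" "(f x, f y) \<notin> rel (transport f \<Gamma>)"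
    using xy assms(2) p by (auto simp: isomorphism_iff)
  then show ?thesis using transport_refines[OF le assms(2)] by (auto simp: refines_less_def)
qed

text \<open>In other words, \<sigma> is 2-isomorphic to the identity of \<Lambda>. This is the
  source of the invariance of \<open>eta\<close>.\<close>

lemma Sym_rel:
  assumes "is_partition \<Lambda>" "\<sigma> \<in> Sym \<Lambda>" "x \<in> pts \<Lambda>"
  shows "(x, \<sigma> x) \<in> rel \<Lambda>"
proof -
  have "rel \<Lambda> `` {x} \<in> blocks \<Lambda>" using assms by (simp add: blocks_def quotientI)
  then have "\<sigma> ` (rel \<Lambda> `` {x}) = rel \<Lambda> `` {x}" using assms by (auto simp: Sym_def)
  moreover have "x \<in> rel \<Lambda> `` {x}" using assms by (simp add: is_partition_refl)
  ultimately show ?thesis by blast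
qed

text \<open>Each point is related to its image, so by symmetry and transitivity moving both points
  of a pair does not affect whether they are related.\<close>

lemma Sym_inv_isomorphism:
  assumes "is_partition \<Lambda>" "\<sigma> \<in> Sym \<Lambda>"
  shows "isomorphism \<Lambda> \<Lambda> (inv_into UNIV \<sigma>)"
proof -
  have p: "\<sigma> permutes pts \<Lambda>" using assms by (simp add: Sym_def)
  let ?s = "inv_into UNIV \<sigma>"
  have s: "?s permutes pts \<Lambda>" using p by (rule permutes_inv)
  have r: "(?s x, x) \<in> rel \<Lambda>" if "x \<in> pts \<Lambda>" for x
    using Sym_rel[OF assms, of "?s x"] that permutes_in_image[OF s] permutes_inverses[OF p] by simp
  have "(x, y) \<in> rel \<Lambda> \<longleftrightarrow> (?s x, ?s y) \<in> rel \<Lambda>" if "x \<in> pts \<Lambda>" "y \<in> pts \<Lambda>" for x y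
    using r that assms(1) by (meson is_partition_sym is_partition_trans)
  then show ?thesis
    using assms(1) permutes_imp_bij[OF s] by (auto simp: isomorphism_iff)
qed

lemma isomorphism_transport_inv:
  assumes "is_partition \<Gamma>" "\<sigma> permutes A"
  shows "isomorphism (transport (inv_into UNIV \<sigma>) \<Gamma>) \<Gamma> \<sigma>"
proof -
  let ?s = "inv_into UNIV \<sigma>" and ?T = "transport (inv_into UNIV \<sigma>) \<Gamma>"
  have c: "\<sigma> (?s x) = x" for x using permutes_inverses[OF assms(2)] by simp
  have "inj ?s" using permutes_inj[OF permutes_inv[OF assms(2)]] .
  then have "is_partition ?T" using assms(1) by (meson is_partition_transport inj_on_subset subset_UNIV)
  then have "isomorphism ?T (transport \<sigma> ?T) \<sigma>"
    using permutes_inj[OF assms(2)] by (meson isomorphism_transport inj_on_subset subset_UNIV)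
  moreover have "transport \<sigma> ?T = \<Gamma>"
    by (cases \<Gamma>) (simp add: transport_def image_image c map_prod_def split_beta)
  ultimately show ?thesis by simp
qed

text \<open>What \<open>PD_act\<close> needs to make sense: the shifted index is again a refinement
  of \<Lambda>, and \<open>bar_tr\<close> is taken along an isomorphism.\<close>

lemma Sym_transport:
  assumes "is_partition \<Lambda>" "\<sigma> \<in> Sym \<Lambda>" "\<Gamma> \<preceq> \<Lambda>"
  shows "transport (inv_into UNIV \<sigma>) \<Gamma> \<preceq> \<Lambda>"
    and "isomorphism (transport (inv_into UNIV \<sigma>) \<Gamma>) \<Gamma> \<sigma>"
  using transport_refines[OF assms(3) Sym_inv_isomorphism[OF assms(1,2)]]
    isomorphism_transport_inv[of \<Gamma> \<sigma> "pts \<Lambda>"] assms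
  by (auto simp: refines_le_iff Sym_def)

section \<open>Disjoint unions and blocks\<close>

lemma inl_inr_simps [simp]:
  "inl x = inl y \<longleftrightarrow> x = y" "inr x = inr y \<longleftrightarrow> x = y" "inl x \<noteq> inr y" "inr y \<noteq> inl x"
  by (auto simp: inl_def inr_def sum_encode_eq)

lemma is_partition_dsum:
  assumes "is_partition \<Lambda>" "is_partition \<Omega>"
  shows "is_partition (\<Lambda> \<uplus> \<Omega>)"
proof -
  have 1: "is_partition (transport inl \<Lambda>)" and 2: "is_partition (transport inr \<Omega>)"
    using assms by (auto intro!: is_partition_transport inj_onI)
  \<comment> \<open>Seen as a union of two transports with disjoint point sets, the disjoint union
    inherits each axiom from the summand that contains the points involved.\<close>
  have e: "\<Lambda> \<uplus> \<Omega> = Part (pts (transport inl \<Lambda>) \<union> pts (transport inr \<Omega>))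
      (rel (transport inl \<Lambda>) \<union> rel (transport inr \<Omega>))"
    by (simp add: dsum_def transport_def)
  have d: "pts (transport inl \<Lambda>) \<inter> pts (transport inr \<Omega>) = {}"
    by (auto simp: transport_def)
  show ?thesis
    unfolding e
  proof (rule is_partitionI; simp)
    show "finite (pts (transport inl \<Lambda>)) \<and> finite (pts (transport inr \<Omega>))"
      using 1 2 by (simp add: is_partition_def)
    fix x y z
    assume "(x, y) \<in> rel (transport inl \<Lambda>) \<or> (x, y) \<in> rel (transport inr \<Omega>)"
      "(y, z) \<in> rel (transport inl \<Lambda>) \<or> (y, z) \<in> rel (transport inr \<Omega>)"
    then show "(x, z) \<in> rel (transport inl \<Lambda>) \<or> (x, z) \<in> rel (transport inr \<Omega>)"
      using d rel_in_pts[OF 1] rel_in_pts[OF 2] is_partition_trans[OF 1] is_partition_trans[OF 2]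
      by (meson disjoint_iff)
  next
    show "rel (transport inl \<Lambda>) \<subseteq> (pts (transport inl \<Lambda>) \<union> pts (transport inr \<Omega>)) \<times>
        (pts (transport inl \<Lambda>) \<union> pts (transport inr \<Omega>)) \<and>
      rel (transport inr \<Omega>) \<subseteq> (pts (transport inl \<Lambda>) \<union> pts (transport inr \<Omega>)) \<times>
        (pts (transport inl \<Lambda>) \<union> pts (transport inr \<Omega>))"
      using rel_in_pts[OF 1] rel_in_pts[OF 2] by auto
  qed (use is_partition_refl[OF 1] is_partition_refl[OF 2]
      is_partition_sym[OF 1] is_partition_sym[OF 2] in blast)+
qed

lemma pts_dsum: "pts (\<Lambda> \<uplus> \<Omega>) = inl ` pts \<Lambda> \<union> inr ` pts \<Omega>"
  by (simp add: dsum_def)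

lemma rel_dsum [simp]:
  "(inl a, inl b) \<in> rel (\<Lambda> \<uplus> \<Omega>) \<longleftrightarrow> (a, b) \<in> rel \<Lambda>"
  "(inr a, inr b) \<in> rel (\<Lambda> \<uplus> \<Omega>) \<longleftrightarrow> (a, b) \<in> rel \<Omega>"
  "(inl a, inr b) \<notin> rel (\<Lambda> \<uplus> \<Omega>)"
  "(inr a, inl b) \<notin> rel (\<Lambda> \<uplus> \<Omega>)"
  by (auto simp: dsum_def)

lemma rel_dsum_iff:
  "(x, y) \<in> rel (\<Lambda> \<uplus> \<Omega>) \<longleftrightarrow> (\<exists>a b. x = inl a \<and> y = inl b \<and> (a, b) \<in> rel \<Lambda>) \<or>
     (\<exists>a b. x = inr a \<and> y = inr b \<and> (a, b) \<in> rel \<Omega>)"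
  by (auto simp: dsum_def)

lemma dcase_inl_inr [simp]: "dcase f g (inl x) = f x" "dcase f g (inr x) = g x"
  by (simp_all add: dcase_def inl_def inr_def)

lemma dsum_map_inl_inr [simp]:
  "dsum_map f g (inl x) = inl (f x)" "dsum_map f g (inr x) = inr (g x)"
  by (simp_all add: dsum_map_def)

lemma untag_inl_inr [simp]: "untag (inl x) = x" "untag (inr x) = x"
  by (simp_all add: untag_def)

lemma concat_map_inl_inr [simp]: "concat_map i (inl x) = x" "concat_map i (inr x) = i + x"
  by (simp_all add: concat_map_def)

text \<open>Holds on all natural numbers because every number carries exactly one tag. It lets
  \<open>ext_tr\<close> be applied to refinements, whose underlying map is
  \<open>id\<close>.\<close>

lemma dsum_map_id: "dsum_map id id = id"
proof
  fix n
  show "dsum_map id id n = id n"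
    by (cases "sum_decode n") (simp_all add: dsum_map_def dcase_def inl_def inr_def, (metis sum_decode_inverse)+)
qed

lemma morphism_dsum_map:
  assumes f: "morphism \<Lambda> \<Lambda>' f" and g: "morphism \<Omega> \<Omega>' g"
  shows "morphism (\<Lambda> \<uplus> \<Omega>) (\<Lambda>' \<uplus> \<Omega>') (dsum_map f g)"
proof -
  have b: "bij_betw f (pts \<Lambda>) (pts \<Lambda>')" "bij_betw g (pts \<Omega>) (pts \<Omega>')"
    using f g by (auto simp: morphism_def)
  have inj: "inj_on f (pts \<Lambda>)" "inj_on g (pts \<Omega>)" using b by (simp_all add: bij_betw_def)
  have "inj_on (dsum_map f g) (pts (\<Lambda> \<uplus> \<Omega>))"
    unfolding pts_dsum by (intro inj_onI) (auto dest: inj_onD[OF inj(1)] inj_onD[OF inj(2)])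
  moreover have "dsum_map f g ` pts (\<Lambda> \<uplus> \<Omega>) = inl ` f ` pts \<Lambda> \<union> inr ` g ` pts \<Omega>"
    by (simp add: pts_dsum image_Un image_image)
  then have "dsum_map f g ` pts (\<Lambda> \<uplus> \<Omega>) = pts (\<Lambda>' \<uplus> \<Omega>')"
    using b by (simp add: pts_dsum bij_betw_def)
  moreover have "(dsum_map f g x, dsum_map f g y) \<in> rel (\<Lambda>' \<uplus> \<Omega>')"
    if "(x, y) \<in> rel (\<Lambda> \<uplus> \<Omega>)" for x y
    using that f g unfolding rel_dsum_iff[of x y] by (auto simp: morphism_def)
  ultimately show ?thesis
    using morphism_def f g by (simp add: is_partition_dsum bij_betw_def)
qed

lemma morphism_concat_map: "morphism (std i \<uplus> std j) (std (i + j)) (concat_map i)"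
proof (rule morphism_std)
  show "is_partition (std i \<uplus> std j)" by (simp add: is_partition_dsum is_partition_std)
  have "concat_map i ` pts (std i \<uplus> std j) = {1..i} \<union> (+) i ` {1..j}"
    by (simp add: pts_dsum image_Un image_image)
  also have "(+) i ` {1..j} = {i + 1..i + j}" by (simp add: image_add_atLeastAtMost)
  also have "{1..i} \<union> {i + 1..i + j} = {1..i + j}" by auto
  finally show "bij_betw (concat_map i) (pts (std i \<uplus> std j)) {1..i + j}"
    by (auto simp: bij_betw_def pts_dsum inj_on_def)
qed

text \<open>A pair witnessing strictness of the refinement is tagged to give a witness in the
  disjoint union.\<close>

lemma dsum_refines_less:
  assumes "is_partition \<Omega>" "\<Psi> \<prec> \<Lambda>"
  shows "\<Psi> \<uplus> \<Omega> \<prec> \<Lambda> \<uplus> \<Omega>" "\<Omega> \<uplus> \<Psi> \<prec> \<Omega> \<uplus> \<Lambda>"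
proof -
  have h: "is_partition \<Psi>" "is_partition \<Lambda>" "pts \<Psi> = pts \<Lambda>" "rel \<Psi> \<subseteq> rel \<Lambda>"
    using assms(2) by (auto simp: refines_less_iff)
  obtain x y where xy: "(x, y) \<in> rel \<Lambda>" "(x, y) \<notin> rel \<Psi>"
    using assms(2) by (auto simp: refines_less_iff)
  have "(inl x, inl y) \<in> rel (\<Lambda> \<uplus> \<Omega>) - rel (\<Psi> \<uplus> \<Omega>)" "(inr x, inr y) \<in> rel (\<Omega> \<uplus> \<Lambda>) - rel (\<Omega> \<uplus> \<Psi>)"
    using xy by auto
  moreover have "rel (\<Psi> \<uplus> \<Omega>) \<subseteq> rel (\<Lambda> \<uplus> \<Omega>)" "rel (\<Omega> \<uplus> \<Psi>) \<subseteq> rel (\<Omega> \<uplus> \<Lambda>)"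
    using subsetD[OF h(4)] by (auto simp: rel_dsum_iff)
  ultimately have "rel (\<Psi> \<uplus> \<Omega>) \<subset> rel (\<Lambda> \<uplus> \<Omega>)" "rel (\<Omega> \<uplus> \<Psi>) \<subset> rel (\<Omega> \<uplus> \<Lambda>)"
    by blast+
  then show "\<Psi> \<uplus> \<Omega> \<prec> \<Lambda> \<uplus> \<Omega>" "\<Omega> \<uplus> \<Psi> \<prec> \<Omega> \<uplus> \<Lambda>"
    using h(1-3) assms(1) by (simp_all add: refines_less_iff is_partition_dsum pts_dsum)
qed

section \<open>Blocks and their sizes\<close>

lemma blocks_partition:
  assumes "is_partition \<Gamma>"
  shows "finite (blocks \<Gamma>)" "\<Union> (blocks \<Gamma>) = pts \<Gamma>" "pairwise disjnt (blocks \<Gamma>)"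
    "B \<in> blocks \<Gamma> \<Longrightarrow> finite B" "B \<in> blocks \<Gamma> \<Longrightarrow> B \<noteq> {}"
proof -
  have e: "equiv (pts \<Gamma>) (rel \<Gamma>)" and f: "finite (pts \<Gamma>)"
    using assms by (auto simp: is_partition_def)
  show "finite (blocks \<Gamma>)"
    using finite_quotient[OF f equiv_type[OF e]] by (simp add: blocks_def)
  show U: "\<Union> (blocks \<Gamma>) = pts \<Gamma>" using Union_quotient[OF e] by (simp add: blocks_def)
  show "pairwise disjnt (blocks \<Gamma>)"
    using quotient_disj[OF e] by (auto simp: blocks_def pairwise_def disjnt_def)
  show "B \<in> blocks \<Gamma> \<Longrightarrow> finite B"
    using U f by (metis Sup_upper finite_subset)
  show "B \<in> blocks \<Gamma> \<Longrightarrow> B \<noteq> {}"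
    using in_quotient_imp_non_empty[OF e] by (simp add: blocks_def)
qed

text \<open>\<open>block_prod_list\<close> ends over \<open>of_blocks\<close>, whereas the
  components of \<open>eta\<close> are indexed by the partition itself, so an equality is required
  and not just an isomorphism.\<close>

lemma of_blocks_blocks:
  assumes "is_partition \<Gamma>"
  shows "of_blocks (blocks \<Gamma>) = \<Gamma>"
proof -
  have e: "equiv (pts \<Gamma>) (rel \<Gamma>)" using assms by (simp add: is_partition_def)
  have "(\<Union>B\<in>blocks \<Gamma>. B \<times> B) = rel \<Gamma>"
  proof (intro equalityI subsetI)
    fix p assume "p \<in> (\<Union>B\<in>blocks \<Gamma>. B \<times> B)"
    then show "p \<in> rel \<Gamma>"
      using in_quotient_imp_in_rel[OF e] by (auto simp: blocks_def)
  next
    fix p assume "p \<in> rel \<Gamma>"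
    then obtain x y where p: "p = (x, y)" "(x, y) \<in> rel \<Gamma>" by (cases p) auto
    then have x: "x \<in> pts \<Gamma>" using rel_in_pts[OF assms] by blast
    let ?B = "rel \<Gamma> `` {x}"
    have "?B \<in> blocks \<Gamma>" unfolding blocks_def using x by (rule quotientI)
    moreover have "p \<in> ?B \<times> ?B" using p is_partition_refl[OF assms x] by simp
    ultimately show "p \<in> (\<Union>B\<in>blocks \<Gamma>. B \<times> B)" by blast
  qed
  then show ?thesis using blocks_partition(2)[OF assms] by (simp add: of_blocks_def)
qed

lemma is_partition_of_blocks:
  assumes "finite \<B>" "pairwise disjnt \<B>" "\<And>B. B \<in> \<B> \<Longrightarrow> finite B"
  shows "is_partition (of_blocks \<B>)"
proof (rule is_partitionI)
  fix x y z
  assume "(x, y) \<in> rel (of_blocks \<B>)" "(y, z) \<in> rel (of_blocks \<B>)"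
  then obtain B C where h: "B \<in> \<B>" "x \<in> B" "y \<in> B" "C \<in> \<B>" "y \<in> C" "z \<in> C"
    by (auto simp: of_blocks_def)
  then have "B = C" using assms(2) by (meson disjnt_iff pairwiseD)
  then show "(x, z) \<in> rel (of_blocks \<B>)" using h by (auto simp: of_blocks_def)
qed (use assms in \<open>auto simp: of_blocks_def\<close>)

text \<open>Disjointness of \<open>B\<close> from the other blocks makes \<open>untag\<close>
  injective and keeps points with different tags unrelated.\<close>

lemma isomorphism_untag:
  assumes p: "is_partition (of_blocks \<B>)" "is_partition (of_blocks (insert B \<B>))"
    and B: "finite B" and d: "B \<inter> \<Union>\<B> = {}"
  shows "isomorphism (indisc B \<uplus> of_blocks \<B>) (of_blocks (insert B \<B>)) untag"
proof -
  let ?D = "indisc B \<uplus> of_blocks \<B>" and ?E = "of_blocks (insert B \<B>)"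
  have pD: "is_partition ?D" using p(1) B by (simp add: is_partition_dsum is_partition_indisc)
  have ptsD: "pts ?D = inl ` B \<union> inr ` \<Union>\<B>" by (simp add: pts_dsum of_blocks_def)
  have inj: "inj_on untag (pts ?D)"
    using d by (auto simp: ptsD inj_on_def)
  have img: "untag ` pts ?D = pts ?E"
    unfolding ptsD by (simp add: image_Un image_image of_blocks_def)
  have r: "(x, y) \<in> rel ?D \<longleftrightarrow> (untag x, untag y) \<in> rel ?E" if "x \<in> pts ?D" "y \<in> pts ?D" for x y
    using that d unfolding ptsD
    by (elim UnE imageE) (auto simp: indisc_def of_blocks_def)
  then show ?thesis
    using pD p(2) inj img unfolding isomorphism_iff bij_betw_def by blast
qed

text \<open>The count tested in \<open>divided_monomial\<close>, made a function so that the test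
  reads \<open>block_type \<Gamma> = l\<close> and extends to membership in a set of exponent
  sequences.\<close>

definition block_type :: "part \<Rightarrow> nat \<Rightarrow> nat" where
  "block_type \<Gamma> i = card {B \<in> blocks \<Gamma>. card B = i}"

lemma blocks_transport:
  assumes "is_partition \<Gamma>" "inj_on f (pts \<Gamma>)"
  shows "blocks (transport f \<Gamma>) = (`) f ` blocks \<Gamma>"
proof -
  have "rel (transport f \<Gamma>) `` {f x} = f ` (rel \<Gamma> `` {x})" if "x \<in> pts \<Gamma>" for x
  proof (intro equalityI subsetI)
    fix y assume "y \<in> rel (transport f \<Gamma>) `` {f x}"
    then obtain a b where h: "f a = f x" "y = f b" "(a, b) \<in> rel \<Gamma>"
      by (auto simp: transport_def)
    then have "a = x" using assms that by (meson inj_onD rel_in_pts)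
    then show "y \<in> f ` (rel \<Gamma> `` {x})" using h by blast
  qed (auto simp: transport_def)
  then show ?thesis
    by (auto simp: blocks_def quotient_def transport_def)
qed

text \<open>An injection sends distinct blocks to distinct blocks of the same size. Hence selecting
  components by block type is compatible with the action of \<open>Sym\<close>.\<close>

lemma block_type_transport:
  assumes "is_partition \<Gamma>" "inj_on f (pts \<Gamma>)"
  shows "block_type (transport f \<Gamma>) = block_type \<Gamma>"
proof
  fix i
  have sub: "B \<subseteq> pts \<Gamma>" if "B \<in> blocks \<Gamma>" for B
    using that blocks_partition(2)[OF assms(1)] by blast
  have c: "card (f ` B) = card B" if "B \<in> blocks \<Gamma>" for B
    using sub[OF that] assms(2) by (meson card_image inj_on_subset)
  have "{B \<in> blocks (transport f \<Gamma>). card B = i} = (`) f ` {B \<in> blocks \<Gamma>. card B = i}"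
    using c by (auto simp: blocks_transport[OF assms])
  moreover have "inj_on ((`) f) {B \<in> blocks \<Gamma>. card B = i}"
    using assms(2) sub by (intro inj_on_image inj_on_subset[OF assms(2)]) blast
  ultimately show "block_type (transport f \<Gamma>) i = block_type \<Gamma> i"
    by (simp add: block_type_def card_image)
qed

text \<open>Counting points block by block and grouping the blocks by size gives the weight; the
  entry at index 0 vanishes because blocks are nonempty.\<close>

lemma block_type_exponents:
  assumes "is_partition \<Gamma>"
  shows "block_type \<Gamma> \<in> exponents (card (pts \<Gamma>))"
proof -
  note b = blocks_partition[OF assms]
  have supp: "{i. block_type \<Gamma> i \<noteq> 0} = card ` blocks \<Gamma>"
    using b(1) by (auto simp: block_type_def card_eq_0_iff)
  have "card (pts \<Gamma>) = (\<Sum>B\<in>blocks \<Gamma>. card B)"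
    using card_Union_disjoint[OF b(3)] b(2,4) by simp
  also have "\<dots> = (\<Sum>i\<in>card ` blocks \<Gamma>. \<Sum>B | B \<in> blocks \<Gamma> \<and> card B = i. card B)"
    using b(1) by (rule sum.image_gen)
  also have "\<dots> = (\<Sum>i | block_type \<Gamma> i \<noteq> 0. i * block_type \<Gamma> i)"
    unfolding supp by (intro sum.cong) (auto simp: block_type_def)
  finally have "(\<Sum>i | block_type \<Gamma> i \<noteq> 0. i * block_type \<Gamma> i) = card (pts \<Gamma>)" by simp
  moreover have "block_type \<Gamma> 0 = 0"
    using b(4,5) by (auto simp: block_type_def card_eq_0_iff)
  moreover have "finite {i. block_type \<Gamma> i \<noteq> 0}"
    using b(1) unfolding supp by simp
  ultimately show ?thesis by (simp add: exponents_def)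
qed

text \<open>If \<open>l i\<close> is nonzero then \<open>i\<close> is positive as well, so the bound
  \<open>i * l i \<le> m\<close> bounds both factors by \<open>m\<close>.\<close>

lemma finite_exponents: "finite (exponents m)"
proof -
  have "exponents m \<subseteq> {l. \<forall>i. (i \<in> {..m} \<longrightarrow> l i \<in> {..m}) \<and> (i \<notin> {..m} \<longrightarrow> l i = 0)}"
  proof
    fix l assume l: "l \<in> exponents m"
    have "i \<le> m \<and> l i \<le> m" if "l i \<noteq> 0" for i
    proof -
      have "i * l i \<le> (\<Sum>i | l i \<noteq> 0. i * l i)"
        using l that by (intro member_le_sum) (auto simp: exponents_def)
      then have "i * l i \<le> m" using l by (simp add: exponents_def)
      moreover have "i \<noteq> 0" using l that by (auto simp: exponents_def intro: ccontr)
      ultimately show ?thesis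
        using that mult_le_mono2[of 1 "l i" i] mult_le_mono1[of 1 i "l i"] by linarith
    qed
    then show "l \<in> {l. \<forall>i. (i \<in> {..m} \<longrightarrow> l i \<in> {..m}) \<and> (i \<notin> {..m} \<longrightarrow> l i = 0)}"
      by force
  qed
  then show ?thesis
    by (rule finite_subset)
       (rule finite_set_of_finite_funs[OF finite_atMost[of m] finite_atMost[of m], of 0])
qed

section \<open>The quotient by transfers\<close>

context partition_ring
begin

section \<open>Closure and additivity of the structure maps\<close>

lemma val_ring: "is_partition \<Lambda> \<Longrightarrow> ring (val R \<Lambda>)"
  using val_cring cring.axioms(1) by blast

lemma val_add_closed:
  "is_partition \<Lambda> \<Longrightarrow> x \<in> carrier (val R \<Lambda>) \<Longrightarrow> y \<in> carrier (val R \<Lambda>) \<Longrightarrow>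
    x \<oplus>\<^bsub>val R \<Lambda>\<^esub> y \<in> carrier (val R \<Lambda>)"
  by (meson abelian_group.axioms(1) abelian_monoid.a_closed val_group)

lemma morphism_parts: "morphism \<Lambda> \<Omega> f \<Longrightarrow> is_partition \<Lambda> \<and> is_partition \<Omega>"
  by (simp add: morphism_def)

lemma val_zero_closed: "is_partition \<Lambda> \<Longrightarrow> \<zero>\<^bsub>val R \<Lambda>\<^esub> \<in> carrier (val R \<Lambda>)"
  by (meson abelian_group.axioms(1) abelian_monoid.zero_closed val_group)

lemma res_closed:
  "morphism \<Lambda> \<Omega> f \<Longrightarrow> x \<in> carrier (val R \<Omega>) \<Longrightarrow> res R \<Lambda> \<Omega> f x \<in> carrier (val R \<Lambda>)"
  using hom_in_carrier[OF res_hom] by fastforce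

lemma tr_closed:
  "morphism \<Lambda> \<Omega> f \<Longrightarrow> x \<in> carrier (val R \<Lambda>) \<Longrightarrow> tr R \<Lambda> \<Omega> f x \<in> carrier (val R \<Omega>)"
  using hom_in_carrier[OF tr_hom] by fastforce

lemma tr_add:
  "morphism \<Lambda> \<Omega> f \<Longrightarrow> x \<in> carrier (val R \<Lambda>) \<Longrightarrow> y \<in> carrier (val R \<Lambda>) \<Longrightarrow>
    tr R \<Lambda> \<Omega> f (x \<oplus>\<^bsub>val R \<Lambda>\<^esub> y) = tr R \<Lambda> \<Omega> f x \<oplus>\<^bsub>val R \<Omega>\<^esub> tr R \<Lambda> \<Omega> f y"
  using hom_mult[OF tr_hom] by fastforce

lemma additive_zero:
  assumes "h \<in> hom (add_monoid (val R \<Lambda>)) (add_monoid (val R \<Omega>))"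
    "is_partition \<Lambda>" "is_partition \<Omega>"
  shows "h \<zero>\<^bsub>val R \<Lambda>\<^esub> = \<zero>\<^bsub>val R \<Omega>\<^esub>"
  using hom_one[OF assms(1)] assms(2,3) val_group abelian_group.a_group by fastforce

lemma tr_zero:
  assumes "morphism \<Lambda> \<Omega> f"
  shows "tr R \<Lambda> \<Omega> f \<zero>\<^bsub>val R \<Lambda>\<^esub> = \<zero>\<^bsub>val R \<Omega>\<^esub>"
  using additive_zero[OF tr_hom[OF assms]] morphism_parts[OF assms] by blast

lemma ext_closed:
  assumes "is_partition \<Lambda>" "is_partition \<Omega>" "x \<in> carrier (val R \<Lambda>)" "y \<in> carrier (val R \<Omega>)"
  shows "ext R \<Lambda> \<Omega> x y \<in> carrier (val R (\<Lambda> \<uplus> \<Omega>))"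
  using hom_in_carrier[OF ext_hom_left[OF assms(1,2,4)]] assms(3) by simp

lemma tr_inv_into_right:
  assumes "isomorphism \<Lambda> \<Omega> f" "x \<in> carrier (val R \<Omega>)"
  shows "tr R \<Lambda> \<Omega> f (tr R \<Omega> \<Lambda> (inv_into (pts \<Lambda>) f) x) = x"
proof -
  let ?g = "inv_into (pts \<Lambda>) f"
  have b: "bij_betw f (pts \<Lambda>) (pts \<Omega>)" and p: "is_partition \<Omega>"
    using assms by (auto simp: isomorphism_iff)
  have m: "morphism \<Lambda> \<Omega> f" "morphism \<Omega> \<Lambda> ?g" using assms by (auto simp: isomorphism_def)
  have "tr R \<Lambda> \<Omega> f (tr R \<Omega> \<Lambda> ?g x) = tr R \<Omega> \<Omega> (f \<circ> ?g) x"
    using tr_comp[OF m(2,1) assms(2)] by simp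
  \<comment> \<open>\<open>f \<circ> ?g\<close> is the identity only on \<open>pts \<Omega>\<close>,
    so functoriality alone is not enough here.\<close>
  also have "\<dots> = tr R \<Omega> \<Omega> id x"
  proof (rule tr_two_iso)
    show "morphism \<Omega> \<Omega> (f \<circ> ?g)" using m by (intro morphism_comp)
    show "morphism \<Omega> \<Omega> id" using p by (simp add: morphism_def)
    show "two_iso \<Omega> \<Omega> (f \<circ> ?g) id"
      using p bij_betw_inv_into_right[OF b] by (intro two_iso_eq_on) auto
  qed (use assms in simp)
  also have "\<dots> = x" using p assms(2) by (rule tr_id)
  finally show ?thesis .
qed

section \<open>The ideal generated by proper transfers\<close>

lemma tr_idealI:
  "z = (\<Oplus>\<^bsub>val R \<Gamma>\<^esub>\<Omega>\<in>{\<Omega>. \<Omega> \<prec> \<Gamma>}. tr R \<Omega> \<Gamma> id (a \<Omega>)) \<Longrightarrow>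
    (\<And>\<Omega>. \<Omega> \<prec> \<Gamma> \<Longrightarrow> a \<Omega> \<in> carrier (val R \<Omega>)) \<Longrightarrow> z \<in> tr_ideal R \<Gamma>"
  unfolding tr_ideal_def by blast

lemma zero_in_tr_ideal: "is_partition \<Gamma> \<Longrightarrow> \<zero>\<^bsub>val R \<Gamma>\<^esub> \<in> tr_ideal R \<Gamma>"
proof -
  assume p: "is_partition \<Gamma>"
  interpret ring "val R \<Gamma>" using p by (rule val_ring)
  have "(\<Oplus>\<^bsub>val R \<Gamma>\<^esub>\<Omega>\<in>{\<Omega>. \<Omega> \<prec> \<Gamma>}. tr R \<Omega> \<Gamma> id \<zero>\<^bsub>val R \<Omega>\<^esub>) = \<zero>\<^bsub>val R \<Gamma>\<^esub>"
    by (intro add.finprod_one_eqI) (auto simp: refines_less_def refines_le_def tr_zero)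
  from this[symmetric] show ?thesis
    by (rule tr_idealI) (simp add: refines_less_iff val_zero_closed)
qed

lemma tr_ideal_add:
  assumes p: "is_partition \<Gamma>" and x: "x \<in> tr_ideal R \<Gamma>" and y: "y \<in> tr_ideal R \<Gamma>"
  shows "x \<oplus>\<^bsub>val R \<Gamma>\<^esub> y \<in> tr_ideal R \<Gamma>"
proof -
  interpret ring "val R \<Gamma>" using p by (rule val_ring)
  obtain a b where ab: "x = (\<Oplus>\<^bsub>val R \<Gamma>\<^esub>\<Omega>\<in>{\<Omega>. \<Omega> \<prec> \<Gamma>}. tr R \<Omega> \<Gamma> id (a \<Omega>))"
      "y = (\<Oplus>\<^bsub>val R \<Gamma>\<^esub>\<Omega>\<in>{\<Omega>. \<Omega> \<prec> \<Gamma>}. tr R \<Omega> \<Gamma> id (b \<Omega>))"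
      "\<And>\<Omega>. \<Omega> \<prec> \<Gamma> \<Longrightarrow> a \<Omega> \<in> carrier (val R \<Omega>)" "\<And>\<Omega>. \<Omega> \<prec> \<Gamma> \<Longrightarrow> b \<Omega> \<in> carrier (val R \<Omega>)"
    using x y unfolding tr_ideal_def by blast
  have m: "morphism \<Omega> \<Gamma> id" if "\<Omega> \<prec> \<Gamma>" for \<Omega>
    using that by (simp add: refines_less_def refines_le_def)
  have "x \<oplus>\<^bsub>val R \<Gamma>\<^esub> y = (\<Oplus>\<^bsub>val R \<Gamma>\<^esub>\<Omega>\<in>{\<Omega>. \<Omega> \<prec> \<Gamma>}.
      tr R \<Omega> \<Gamma> id (a \<Omega>) \<oplus>\<^bsub>val R \<Gamma>\<^esub> tr R \<Omega> \<Gamma> id (b \<Omega>))"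
    unfolding ab(1,2) using ab(3,4) m
    by (subst finsum_addf) (auto intro!: tr_closed)
  also have "\<dots> = (\<Oplus>\<^bsub>val R \<Gamma>\<^esub>\<Omega>\<in>{\<Omega>. \<Omega> \<prec> \<Gamma>}. tr R \<Omega> \<Gamma> id (a \<Omega> \<oplus>\<^bsub>val R \<Omega>\<^esub> b \<Omega>))"
    using ab(3,4) m by (intro finsum_cong') (auto simp: tr_add tr_closed)
  finally show ?thesis
    by (rule tr_idealI) (use ab(3,4) val_add_closed in \<open>simp add: refines_less_iff\<close>)
qed

lemma tr_in_tr_ideal:
  assumes "\<Omega> \<prec> \<Gamma>" "a \<in> carrier (val R \<Omega>)"
  shows "tr R \<Omega> \<Gamma> id a \<in> tr_ideal R \<Gamma>"
proof -
  have p: "is_partition \<Gamma>" using assms by (simp add: refines_less_iff)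
  interpret ring "val R \<Gamma>" using p by (rule val_ring)
  \<comment> \<open>The family concentrated at \<Omega>, so that all other summands are transfers of
    zero.\<close>
  let ?a = "\<lambda>\<Psi>. if \<Omega> = \<Psi> then a else \<zero>\<^bsub>val R \<Psi>\<^esub>"
  have m: "morphism \<Psi> \<Gamma> id" if "\<Psi> \<prec> \<Gamma>" for \<Psi>
    using that by (simp add: refines_less_def refines_le_def)
  have "(\<Oplus>\<^bsub>val R \<Gamma>\<^esub>\<Psi>\<in>{\<Psi>. \<Psi> \<prec> \<Gamma>}. tr R \<Psi> \<Gamma> id (?a \<Psi>)) =
      (\<Oplus>\<^bsub>val R \<Gamma>\<^esub>\<Psi>\<in>{\<Psi>. \<Psi> \<prec> \<Gamma>}. if \<Omega> = \<Psi> then tr R \<Omega> \<Gamma> id a else \<zero>\<^bsub>val R \<Gamma>\<^esub>)"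
    using assms m by (intro finsum_cong') (auto simp: tr_zero tr_closed)
  also have "\<dots> = tr R \<Omega> \<Gamma> id a"
    using assms m finite_refines_less
    by (intro finsum_singleton[of \<Omega> _ "\<lambda>_. tr R \<Omega> \<Gamma> id a"]) (auto simp: tr_closed)
  finally show ?thesis
    by (intro tr_idealI[of _ _ ?a]) (use assms val_zero_closed in \<open>auto simp: refines_less_iff\<close>)
qed

text \<open>Reduces closure properties of the ideal to a single transfer. The defining sum is built
  up one refinement at a time, which is why the inner induction runs over arbitrary subsets
  \<open>F\<close> of the index set.\<close>

lemma tr_ideal_induct [consumes 2, case_names zero tr add]:
  assumes p: "is_partition \<Gamma>" and z: "z \<in> tr_ideal R \<Gamma>"
    and P0: "P \<zero>\<^bsub>val R \<Gamma>\<^esub>"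
    and Ptr: "\<And>\<Omega> a. \<Omega> \<prec> \<Gamma> \<Longrightarrow> a \<in> carrier (val R \<Omega>) \<Longrightarrow> P (tr R \<Omega> \<Gamma> id a)"
    and Padd: "\<And>x y. x \<in> carrier (val R \<Gamma>) \<Longrightarrow> y \<in> carrier (val R \<Gamma>) \<Longrightarrow> P x \<Longrightarrow> P y \<Longrightarrow>
      P (x \<oplus>\<^bsub>val R \<Gamma>\<^esub> y)"
  shows "P z"
proof -
  interpret ring "val R \<Gamma>" using p by (rule val_ring)
  obtain a where a: "z = (\<Oplus>\<^bsub>val R \<Gamma>\<^esub>\<Omega>\<in>{\<Omega>. \<Omega> \<prec> \<Gamma>}. tr R \<Omega> \<Gamma> id (a \<Omega>))"
      "\<And>\<Omega>. \<Omega> \<prec> \<Gamma> \<Longrightarrow> a \<Omega> \<in> carrier (val R \<Omega>)"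
    using z unfolding tr_ideal_def by blast
  have c: "tr R \<Omega> \<Gamma> id (a \<Omega>) \<in> carrier (val R \<Gamma>)" if "\<Omega> \<prec> \<Gamma>" for \<Omega>
    using that a(2) by (auto intro!: tr_closed simp: refines_less_def refines_le_def)
  have "finite F \<Longrightarrow> F \<subseteq> {\<Omega>. \<Omega> \<prec> \<Gamma>} \<Longrightarrow>
      P (\<Oplus>\<^bsub>val R \<Gamma>\<^esub>\<Omega>\<in>F. tr R \<Omega> \<Gamma> id (a \<Omega>))" for F
  proof (induction F rule: finite_induct)
    case empty
    then show ?case using P0 by simp
  next
    case (insert \<Omega> F)
    let ?f = "\<lambda>\<Omega>. tr R \<Omega> \<Gamma> id (a \<Omega>)"
    have f: "?f \<in> F \<rightarrow> carrier (val R \<Gamma>)" "?f \<Omega> \<in> carrier (val R \<Gamma>)"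
      using c insert.prems by auto
    have "P (?f \<Omega> \<oplus>\<^bsub>val R \<Gamma>\<^esub> finsum (val R \<Gamma>) ?f F)"
    proof (rule Padd)
      show "P (?f \<Omega>)" using insert.prems a(2) by (intro Ptr) auto
      show "P (finsum (val R \<Gamma>) ?f F)" using insert.IH insert.prems by blast
    qed (use f finsum_closed in auto)
    then show ?case by (simp only: finsum_insert[OF insert.hyps f])
  qed
  then show ?thesis using finite_refines_less a(1) by blast
qed

lemma tr_ideal_carrier:
  assumes p: "is_partition \<Gamma>" and z: "z \<in> tr_ideal R \<Gamma>"
  shows "z \<in> carrier (val R \<Gamma>)"
  using assms
proof (induction rule: tr_ideal_induct)
  case (tr \<Omega> a)
  then show ?case by (auto intro!: tr_closed simp: refines_less_def refines_le_def)
qed (auto intro: val_zero_closed[OF p] val_add_closed[OF p])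

text \<open>Absorption is Frobenius reciprocity: a factor outside a transfer becomes a restricted
  factor inside it, leaving a transfer from the same finer partition.\<close>

lemma ideal_tr_ideal:
  assumes p: "is_partition \<Gamma>"
  shows "ideal (tr_ideal R \<Gamma>) (val R \<Gamma>)"
proof -
  interpret cring "val R \<Gamma>" using p by (rule val_cring)
  have l: "x \<otimes>\<^bsub>val R \<Gamma>\<^esub> a \<in> tr_ideal R \<Gamma>"
    if "a \<in> tr_ideal R \<Gamma>" "x \<in> carrier (val R \<Gamma>)" for a x
    using p that(1)
  proof (induction rule: tr_ideal_induct)
    case zero
    then show ?case using that p by (simp add: zero_in_tr_ideal)
  next
    case (tr \<Omega> a)
    then have m: "morphism \<Omega> \<Gamma> id" and q: "is_partition \<Omega>"
      by (auto simp: refines_less_def refines_le_def morphism_def)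
    interpret W: cring "val R \<Omega>" using q by (rule val_cring)
    have "x \<otimes>\<^bsub>val R \<Gamma>\<^esub> tr R \<Omega> \<Gamma> id a = tr R \<Omega> \<Gamma> id (res R \<Omega> \<Gamma> id x \<otimes>\<^bsub>val R \<Omega>\<^esub> a)"
      using frobenius[OF m that(2) tr(2)] by simp
    then show ?case using tr m that(2) by (simp add: tr_in_tr_ideal res_closed)
  next
    case (add y z)
    then show ?case using that p by (simp add: r_distr tr_ideal_add)
  qed
  show ?thesis
  proof (rule idealI)
    show "subgroup (tr_ideal R \<Gamma>) (add_monoid (val R \<Gamma>))"
    proof (rule subgroup.intro)
      fix a assume a: "a \<in> tr_ideal R \<Gamma>"
      then have "a \<in> carrier (val R \<Gamma>)" using p by (simp add: tr_ideal_carrier)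
      \<comment> \<open>Negation is multiplication by minus one, so closure under inverses follows
        from absorption.\<close>
      then have "\<ominus>\<^bsub>val R \<Gamma>\<^esub> a = (\<ominus>\<^bsub>val R \<Gamma>\<^esub> \<one>\<^bsub>val R \<Gamma>\<^esub>) \<otimes>\<^bsub>val R \<Gamma>\<^esub> a"
        by (simp add: l_minus)
      then have "\<ominus>\<^bsub>val R \<Gamma>\<^esub> a \<in> tr_ideal R \<Gamma>"
        using l[OF a, of "\<ominus>\<^bsub>val R \<Gamma>\<^esub> \<one>\<^bsub>val R \<Gamma>\<^esub>"] by simp
      then show "inv\<^bsub>add_monoid (val R \<Gamma>)\<^esub> a \<in> tr_ideal R \<Gamma>"
        by (simp only: a_inv_def)
    qed (use p in \<open>auto simp: tr_ideal_carrier zero_in_tr_ideal tr_ideal_add\<close>)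
  qed (use l p in \<open>auto simp: m_comm tr_ideal_carrier intro: ring_axioms\<close>)
qed

section \<open>Computing in the quotient rings on representatives\<close>

lemma ring_bar: "is_partition \<Gamma> \<Longrightarrow> ring (bar R \<Gamma>)"
  unfolding bar_def by (simp add: ideal_tr_ideal ideal.quotient_is_ring)

lemma bar_proj_hom: "is_partition \<Gamma> \<Longrightarrow> bar_proj R \<Gamma> \<in> ring_hom (val R \<Gamma>) (bar R \<Gamma>)"
  using ideal.rcos_ring_hom[OF ideal_tr_ideal] unfolding bar_def bar_proj_def[abs_def] by simp

lemma bar_carrierE:
  assumes "is_partition \<Gamma>" "S \<in> carrier (bar R \<Gamma>)"
  obtains z where "z \<in> carrier (val R \<Gamma>)" "S = bar_proj R \<Gamma> z"
  using assms unfolding bar_def FactRing_def A_RCOSETS_def' bar_proj_def by auto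

lemma bar_proj_eq_iff:
  assumes "is_partition \<Gamma>" "x \<in> carrier (val R \<Gamma>)" "y \<in> carrier (val R \<Gamma>)"
  shows "bar_proj R \<Gamma> x = bar_proj R \<Gamma> y \<longleftrightarrow> x \<ominus>\<^bsub>val R \<Gamma>\<^esub> y \<in> tr_ideal R \<Gamma>"
  using ring.quotient_eq_iff_same_a_r_cos[OF val_ring ideal_tr_ideal] assms
  unfolding bar_proj_def by blast

lemma bar_proj_zero: "is_partition \<Gamma> \<Longrightarrow> bar_proj R \<Gamma> \<zero>\<^bsub>val R \<Gamma>\<^esub> = \<zero>\<^bsub>bar R \<Gamma>\<^esub>"
  using ring_hom_zero[OF bar_proj_hom val_ring ring_bar] by blast

lemma bar_proj_shift:
  assumes "is_partition \<Gamma>" "i \<in> tr_ideal R \<Gamma>" "x \<in> carrier (val R \<Gamma>)"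
  shows "bar_proj R \<Gamma> (i \<oplus>\<^bsub>val R \<Gamma>\<^esub> x) = bar_proj R \<Gamma> x"
proof -
  interpret cring "val R \<Gamma>" using assms(1) by (rule val_cring)
  have i: "i \<in> carrier (val R \<Gamma>)" using assms tr_ideal_carrier by blast
  then have "i \<oplus>\<^bsub>val R \<Gamma>\<^esub> x \<ominus>\<^bsub>val R \<Gamma>\<^esub> x = i"
    using assms by (simp add: minus_eq a_assoc r_neg)
  then show ?thesis using assms i by (subst bar_proj_eq_iff) auto
qed

lemma bar_proj_memE:
  assumes "s \<in> bar_proj R \<Gamma> z"
  obtains i where "i \<in> tr_ideal R \<Gamma>" "s = i \<oplus>\<^bsub>val R \<Gamma>\<^esub> z"
  using assms unfolding bar_proj_def a_r_coset_def' by auto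

lemma bar_proj_memI: "i \<in> tr_ideal R \<Gamma> \<Longrightarrow> i \<oplus>\<^bsub>val R \<Gamma>\<^esub> z \<in> bar_proj R \<Gamma> z"
  unfolding bar_proj_def a_r_coset_def' by auto

lemma tr_isomorphism_tr_ideal:
  assumes f: "isomorphism \<Lambda> \<Omega> f" and z: "z \<in> tr_ideal R \<Lambda>"
  shows "tr R \<Lambda> \<Omega> f z \<in> tr_ideal R \<Omega>"
proof -
  have p: "is_partition \<Lambda>" "is_partition \<Omega>" and m: "morphism \<Lambda> \<Omega> f"
    and b: "bij_betw f (pts \<Lambda>) (pts \<Omega>)"
    using f by (auto simp: isomorphism_iff isomorphism_morphism)
  show ?thesis using p(1) z
  proof (induction rule: tr_ideal_induct)
    case zero
    then show ?case using p m by (simp add: tr_zero zero_in_tr_ideal)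
  next
    case (tr \<Psi> a)
    then have q: "is_partition \<Psi>" "pts \<Psi> = pts \<Lambda>" and n: "morphism \<Psi> \<Lambda> id"
      by (auto simp: refines_less_iff refines_less_def refines_le_def morphism_def)
    let ?T = "transport f \<Psi>"
    have i: "morphism \<Psi> ?T f"
      using q b by (intro isomorphism_morphism isomorphism_transport) (auto simp: bij_betw_def)
    have T: "?T \<prec> \<Omega>" using tr(1) f by (rule transport_refines_less)
    then have k: "morphism ?T \<Omega> id" by (simp add: refines_less_def refines_le_def)
    \<comment> \<open>Both sides are the transfer along \<open>f\<close> from \<Psi> to \<Omega>,
      factored once through \<Lambda> and once through the transported partition, which is strictly
      finer than \<Omega>.\<close>
    have "tr R \<Lambda> \<Omega> f (tr R \<Psi> \<Lambda> id a) = tr R ?T \<Omega> id (tr R \<Psi> ?T f a)"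
      using tr_comp[OF n m tr(2)] tr_comp[OF i k tr(2)] by simp
    then show ?case using T i tr(2) by (simp add: tr_in_tr_ideal tr_closed)
  next
    case (add x y)
    then show ?case using p m by (simp add: tr_add tr_ideal_add)
  qed
qed

text \<open>\<open>bar_tr\<close> is a direct image of sets, so the image must fill the whole target
  coset; this is where invertibility of \<open>f\<close> enters.\<close>

lemma bar_tr_bar_proj:
  assumes f: "isomorphism \<Lambda> \<Omega> f" and z: "z \<in> carrier (val R \<Lambda>)"
  shows "bar_tr R \<Lambda> \<Omega> f (bar_proj R \<Lambda> z) = bar_proj R \<Omega> (tr R \<Lambda> \<Omega> f z)"
proof -
  have p: "is_partition \<Lambda>" "is_partition \<Omega>" and m: "morphism \<Lambda> \<Omega> f"
    using f by (auto simp: isomorphism_iff isomorphism_morphism)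
  let ?g = "inv_into (pts \<Lambda>) f"
  show ?thesis
    unfolding bar_tr_def
  proof (intro equalityI subsetI)
    fix s assume "s \<in> tr R \<Lambda> \<Omega> f ` bar_proj R \<Lambda> z"
    then obtain i where "i \<in> tr_ideal R \<Lambda>" "s = tr R \<Lambda> \<Omega> f (i \<oplus>\<^bsub>val R \<Lambda>\<^esub> z)"
      by (auto elim: bar_proj_memE)
    then show "s \<in> bar_proj R \<Omega> (tr R \<Lambda> \<Omega> f z)"
      using z p m f by (simp add: tr_add tr_ideal_carrier bar_proj_memI tr_isomorphism_tr_ideal)
  next
    fix s assume "s \<in> bar_proj R \<Omega> (tr R \<Lambda> \<Omega> f z)"
    then obtain i where i: "i \<in> tr_ideal R \<Omega>" "s = i \<oplus>\<^bsub>val R \<Omega>\<^esub> tr R \<Lambda> \<Omega> f z"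
      by (auto elim: bar_proj_memE)
    \<comment> \<open>The ideal element is pulled back along the inverse isomorphism, which keeps it
      in the ideal and cancels against \<open>f\<close>.\<close>
    let ?j = "tr R \<Omega> \<Lambda> ?g i"
    have j: "?j \<in> tr_ideal R \<Lambda>" using isomorphism_inv[OF f] i(1) by (rule tr_isomorphism_tr_ideal)
    moreover have "s = tr R \<Lambda> \<Omega> f (?j \<oplus>\<^bsub>val R \<Lambda>\<^esub> z)"
      using i j m z p tr_inv_into_right[OF f, of i] by (simp add: tr_add tr_ideal_carrier)
    ultimately show "s \<in> tr R \<Lambda> \<Omega> f ` bar_proj R \<Lambda> z"
      using bar_proj_memI by blast
  qed
qed

text \<open>Naturality in pairs of transfers, with the identity on \<Omega>, turns the product of a
  transferred element with \<open>y\<close> into a transfer from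
  \<open>\<Psi> \<uplus> \<Omega>\<close>.\<close>

lemma ext_tr_ideal_left:
  assumes p: "is_partition \<Lambda>" "is_partition \<Omega>" and y: "y \<in> carrier (val R \<Omega>)"
    and i: "i \<in> tr_ideal R \<Lambda>"
  shows "ext R \<Lambda> \<Omega> i y \<in> tr_ideal R (\<Lambda> \<uplus> \<Omega>)"
  using p(1) i
proof (induction rule: tr_ideal_induct)
  case zero
  then show ?case
    using additive_zero[OF ext_hom_left[OF p y]] p by (simp add: is_partition_dsum zero_in_tr_ideal)
next
  case (tr \<Psi> a)
  then have m: "morphism \<Psi> \<Lambda> id" and q: "is_partition \<Psi>"
    by (auto simp: refines_less_def refines_le_def morphism_def)
  have n: "morphism \<Omega> \<Omega> id" using p by (simp add: morphism_def)
  have "tr R (\<Psi> \<uplus> \<Omega>) (\<Lambda> \<uplus> \<Omega>) id (ext R \<Psi> \<Omega> a y) = ext R \<Lambda> \<Omega> (tr R \<Psi> \<Lambda> id a) y"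
    using ext_tr[OF m n tr(2) y] p y by (simp add: dsum_map_id tr_id)
  then show ?case
    using tr_in_tr_ideal[OF dsum_refines_less(1)[OF p(2) tr(1)] ext_closed[OF q p(2) tr(2) y]] by simp
next
  case (add x x')
  then show ?case
    using hom_mult[OF ext_hom_left[OF p y]] p by (simp add: is_partition_dsum tr_ideal_add)
qed

lemma ext_tr_ideal_right:
  assumes p: "is_partition \<Lambda>" "is_partition \<Omega>" and x: "x \<in> carrier (val R \<Lambda>)"
    and i: "i \<in> tr_ideal R \<Omega>"
  shows "ext R \<Lambda> \<Omega> x i \<in> tr_ideal R (\<Lambda> \<uplus> \<Omega>)"
  using p(2) i
proof (induction rule: tr_ideal_induct)
  case zero
  then show ?case
    using additive_zero[OF ext_hom_right[OF p x]] p by (simp add: is_partition_dsum zero_in_tr_ideal)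
next
  case (tr \<Psi> a)
  then have m: "morphism \<Psi> \<Omega> id" and q: "is_partition \<Psi>"
    by (auto simp: refines_less_def refines_le_def morphism_def)
  have n: "morphism \<Lambda> \<Lambda> id" using p by (simp add: morphism_def)
  have "tr R (\<Lambda> \<uplus> \<Psi>) (\<Lambda> \<uplus> \<Omega>) id (ext R \<Lambda> \<Psi> x a) = ext R \<Lambda> \<Omega> x (tr R \<Psi> \<Omega> id a)"
    using ext_tr[OF n m x tr(2)] p x by (simp add: dsum_map_id tr_id)
  then show ?case
    using tr_in_tr_ideal[OF dsum_refines_less(2)[OF p(1) tr(1)] ext_closed[OF p(1) q x tr(2)]] by simp
next
  case (add y y')
  then show ?case
    using hom_mult[OF ext_hom_right[OF p x]] p by (simp add: is_partition_dsum tr_ideal_add)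
qed

lemma bar_proj_self: "is_partition \<Gamma> \<Longrightarrow> x \<in> carrier (val R \<Gamma>) \<Longrightarrow> x \<in> bar_proj R \<Gamma> x"
proof -
  assume p: "is_partition \<Gamma>" and x: "x \<in> carrier (val R \<Gamma>)"
  interpret ring "val R \<Gamma>" using p by (rule val_ring)
  show ?thesis using bar_proj_memI[OF zero_in_tr_ideal[OF p], of x] x by simp
qed

text \<open>\<open>bar_ext\<close> is a union over all representatives, so it is a single coset
  precisely because the cosets being united agree.\<close>

lemma bar_ext_bar_proj:
  assumes p: "is_partition \<Lambda>" "is_partition \<Omega>"
    and x: "x \<in> carrier (val R \<Lambda>)" and y: "y \<in> carrier (val R \<Omega>)"
  shows "bar_ext R \<Lambda> \<Omega> (bar_proj R \<Lambda> x) (bar_proj R \<Omega> y) = bar_proj R (\<Lambda> \<uplus> \<Omega>) (ext R \<Lambda> \<Omega> x y)"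
proof -
  have d: "is_partition (\<Lambda> \<uplus> \<Omega>)" using p by (rule is_partition_dsum)
  have "bar_proj R (\<Lambda> \<uplus> \<Omega>) (ext R \<Lambda> \<Omega> s t) = bar_proj R (\<Lambda> \<uplus> \<Omega>) (ext R \<Lambda> \<Omega> x y)"
    if s: "s \<in> bar_proj R \<Lambda> x" and t: "t \<in> bar_proj R \<Omega> y" for s t
  proof -
    obtain i where i: "i \<in> tr_ideal R \<Lambda>" "s = i \<oplus>\<^bsub>val R \<Lambda>\<^esub> x" using s by (rule bar_proj_memE)
    obtain j where j: "j \<in> tr_ideal R \<Omega>" "t = j \<oplus>\<^bsub>val R \<Omega>\<^esub> y" using t by (rule bar_proj_memE)
    have c: "i \<in> carrier (val R \<Lambda>)" "j \<in> carrier (val R \<Omega>)"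
      using i j p tr_ideal_carrier by auto
    then have t': "t \<in> carrier (val R \<Omega>)" using j y p val_add_closed by simp
    \<comment> \<open>Expanding first in \<open>s\<close> and then in \<open>t\<close> yields
      \<open>ext R \<Lambda> \<Omega> x y\<close> plus two terms with a factor from a transfer
      ideal.\<close>
    have "ext R \<Lambda> \<Omega> s t = ext R \<Lambda> \<Omega> i t \<oplus>\<^bsub>val R (\<Lambda> \<uplus> \<Omega>)\<^esub> ext R \<Lambda> \<Omega> x t"
      using hom_mult[OF ext_hom_left[OF p t'], of i x] c x i(2) by simp
    moreover have "ext R \<Lambda> \<Omega> x t = ext R \<Lambda> \<Omega> x j \<oplus>\<^bsub>val R (\<Lambda> \<uplus> \<Omega>)\<^esub> ext R \<Lambda> \<Omega> x y"
      using hom_mult[OF ext_hom_right[OF p x], of j y] c y j(2) by simp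
    ultimately show ?thesis
      using bar_proj_shift[OF d] ext_tr_ideal_left[OF p t' i(1)] ext_tr_ideal_right[OF p x j(1)]
        ext_closed[OF p x t'] ext_closed[OF p x y] by simp
  qed
  then show ?thesis
    unfolding bar_ext_def
    using bar_proj_self[OF p(1) x] bar_proj_self[OF p(2) y] by blast
qed

lemma bar_proj_closed:
  "is_partition \<Gamma> \<Longrightarrow> z \<in> carrier (val R \<Gamma>) \<Longrightarrow> bar_proj R \<Gamma> z \<in> carrier (bar R \<Gamma>)"
  by (rule ring_hom_closed[OF bar_proj_hom])

lemma bar_tr_add:
  assumes f: "isomorphism \<Lambda> \<Omega> f" and S: "S \<in> carrier (bar R \<Lambda>)" "T \<in> carrier (bar R \<Lambda>)"
  shows "bar_tr R \<Lambda> \<Omega> f (S \<oplus>\<^bsub>bar R \<Lambda>\<^esub> T) =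
    bar_tr R \<Lambda> \<Omega> f S \<oplus>\<^bsub>bar R \<Omega>\<^esub> bar_tr R \<Lambda> \<Omega> f T"
proof -
  have p: "is_partition \<Lambda>" "is_partition \<Omega>" and m: "morphism \<Lambda> \<Omega> f"
    using f by (auto simp: isomorphism_iff isomorphism_morphism)
  obtain x where x: "x \<in> carrier (val R \<Lambda>)" "S = bar_proj R \<Lambda> x" using p(1) S(1) by (rule bar_carrierE)
  obtain y where y: "y \<in> carrier (val R \<Lambda>)" "T = bar_proj R \<Lambda> y" using p(1) S(2) by (rule bar_carrierE)
  have "S \<oplus>\<^bsub>bar R \<Lambda>\<^esub> T = bar_proj R \<Lambda> (x \<oplus>\<^bsub>val R \<Lambda>\<^esub> y)"
    using ring_hom_add[OF bar_proj_hom[OF p(1)] x(1) y(1)] x y by simp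
  moreover have "bar_proj R \<Omega> (tr R \<Lambda> \<Omega> f x) \<oplus>\<^bsub>bar R \<Omega>\<^esub> bar_proj R \<Omega> (tr R \<Lambda> \<Omega> f y) =
      bar_proj R \<Omega> (tr R \<Lambda> \<Omega> f x \<oplus>\<^bsub>val R \<Omega>\<^esub> tr R \<Lambda> \<Omega> f y)"
    using ring_hom_add[OF bar_proj_hom[OF p(2)]] x y tr_closed[OF m] by simp
  ultimately show ?thesis
    using x y p m by (simp add: bar_tr_bar_proj[OF f] val_add_closed tr_add)
qed

lemma bar_tr_zero:
  assumes f: "isomorphism \<Lambda> \<Omega> f"
  shows "bar_tr R \<Lambda> \<Omega> f \<zero>\<^bsub>bar R \<Lambda>\<^esub> = \<zero>\<^bsub>bar R \<Omega>\<^esub>"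
proof -
  have p: "is_partition \<Lambda>" "is_partition \<Omega>" and m: "morphism \<Lambda> \<Omega> f"
    using f by (auto simp: isomorphism_iff isomorphism_morphism)
  show ?thesis
    using bar_tr_bar_proj[OF f val_zero_closed[OF p(1)]] p tr_zero[OF m] by (simp add: bar_proj_zero)
qed

end

section \<open>The ring PD(R)\<close>

lemma PD_val_simps:
  "carrier (PD_val R \<Lambda>) =
    {x \<in> (\<Pi>\<^sub>E \<Gamma>\<in>{\<Gamma>. \<Gamma> \<preceq> \<Lambda>}. carrier (bar R \<Gamma>)). \<forall>\<sigma>\<in>Sym \<Lambda>. PD_act R \<Lambda> \<sigma> x = x}"
  "x \<otimes>\<^bsub>PD_val R \<Lambda>\<^esub> y = (\<lambda>\<Gamma>\<in>{\<Gamma>. \<Gamma> \<preceq> \<Lambda>}. x \<Gamma> \<otimes>\<^bsub>bar R \<Gamma>\<^esub> y \<Gamma>)"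
  "x \<oplus>\<^bsub>PD_val R \<Lambda>\<^esub> y = (\<lambda>\<Gamma>\<in>{\<Gamma>. \<Gamma> \<preceq> \<Lambda>}. x \<Gamma> \<oplus>\<^bsub>bar R \<Gamma>\<^esub> y \<Gamma>)"
  "\<zero>\<^bsub>PD_val R \<Lambda>\<^esub> = (\<lambda>\<Gamma>\<in>{\<Gamma>. \<Gamma> \<preceq> \<Lambda>}. \<zero>\<^bsub>bar R \<Gamma>\<^esub>)"
  by (simp_all add: PD_val_def)

lemma val_PD [simp]: "val (PD R) = PD_val R"
  by (simp add: PD_def)

context partition_ring
begin

text \<open>Away from the refinements of \<Lambda> both \<open>x\<close> and
  \<open>PD_act R \<Lambda> \<sigma> x\<close> are \<open>undefined\<close>, so invariance can be
  tested on components.\<close>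

lemma PD_carrier_iff:
  "x \<in> carrier (PD_val R \<Lambda>) \<longleftrightarrow> x \<in> (\<Pi>\<^sub>E \<Gamma>\<in>{\<Gamma>. \<Gamma> \<preceq> \<Lambda>}. carrier (bar R \<Gamma>)) \<and>
    (\<forall>\<sigma>\<in>Sym \<Lambda>. \<forall>\<Gamma>. \<Gamma> \<preceq> \<Lambda> \<longrightarrow>
      bar_tr R (transport (inv_into UNIV \<sigma>) \<Gamma>) \<Gamma> \<sigma> (x (transport (inv_into UNIV \<sigma>) \<Gamma>)) = x \<Gamma>)"
proof -
  have "PD_act R \<Lambda> \<sigma> x = x \<longleftrightarrow> (\<forall>\<Gamma>. \<Gamma> \<preceq> \<Lambda> \<longrightarrow>
      bar_tr R (transport (inv_into UNIV \<sigma>) \<Gamma>) \<Gamma> \<sigma> (x (transport (inv_into UNIV \<sigma>) \<Gamma>)) = x \<Gamma>)"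
    if "x \<in> (\<Pi>\<^sub>E \<Gamma>\<in>{\<Gamma>. \<Gamma> \<preceq> \<Lambda>}. carrier (bar R \<Gamma>))" for \<sigma>
    using that unfolding PD_act_def fun_eq_iff
    by (auto simp: restrict_def PiE_def extensional_def)
  then show ?thesis by (auto simp: PD_val_simps)
qed

text \<open>The structure needed to evaluate the \<open>finsum\<close> in \<open>PD_exp\<close>.
  Sums stay invariant because \<open>bar_tr\<close> is additive along isomorphisms.\<close>

lemma abelian_monoid_PD_val:
  assumes p: "is_partition \<Lambda>"
  shows "abelian_monoid (PD_val R \<Lambda>)"
proof -
  have q: "is_partition \<Gamma>" if "\<Gamma> \<preceq> \<Lambda>" for \<Gamma> using that by (simp add: refines_le_iff)
  have mem: "x \<Gamma> \<in> carrier (bar R \<Gamma>)" if "x \<in> carrier (PD_val R \<Lambda>)" "\<Gamma> \<preceq> \<Lambda>" for x \<Gamma>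
    using that by (auto simp: PD_val_simps)
  have exten: "x \<in> extensional {\<Gamma>. \<Gamma> \<preceq> \<Lambda>}" if "x \<in> carrier (PD_val R \<Lambda>)" for x
    using that by (auto simp: PD_val_simps PiE_def)
  show ?thesis
  proof (rule abelian_monoidI)
    fix x y assume x: "x \<in> carrier (PD_val R \<Lambda>)" and y: "y \<in> carrier (PD_val R \<Lambda>)"
    have "x \<Gamma> \<oplus>\<^bsub>bar R \<Gamma>\<^esub> y \<Gamma> \<in> carrier (bar R \<Gamma>)" if "\<Gamma> \<preceq> \<Lambda>" for \<Gamma>
      using ring.ring_simprules(1)[OF ring_bar[OF q[OF that]]] mem[OF x that] mem[OF y that] by simp
    moreover have "bar_tr R T \<Gamma> \<sigma> (x T \<oplus>\<^bsub>bar R T\<^esub> y T) = x \<Gamma> \<oplus>\<^bsub>bar R \<Gamma>\<^esub> y \<Gamma>"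
      if s: "\<sigma> \<in> Sym \<Lambda>" "\<Gamma> \<preceq> \<Lambda>" and T: "T = transport (inv_into UNIV \<sigma>) \<Gamma>" for \<sigma> \<Gamma> T
      using bar_tr_add[OF Sym_transport(2)[OF p s] mem[OF x Sym_transport(1)[OF p s]]
          mem[OF y Sym_transport(1)[OF p s]]] x y s
      unfolding PD_carrier_iff T by simp
    ultimately show "x \<oplus>\<^bsub>PD_val R \<Lambda>\<^esub> y \<in> carrier (PD_val R \<Lambda>)"
      using Sym_transport(1)[OF p] unfolding PD_carrier_iff by (simp add: PD_val_simps(3))
    show "x \<oplus>\<^bsub>PD_val R \<Lambda>\<^esub> y = y \<oplus>\<^bsub>PD_val R \<Lambda>\<^esub> x"
      unfolding PD_val_simps(3)
      by (rule restrict_ext)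
         (use ring.ring_simprules(10)[OF ring_bar[OF q]] mem[OF x] mem[OF y] in auto)
  next
    show "\<zero>\<^bsub>PD_val R \<Lambda>\<^esub> \<in> carrier (PD_val R \<Lambda>)"
      using Sym_transport[OF p] ring.ring_simprules(2)[OF ring_bar[OF q]]
      unfolding PD_carrier_iff by (simp add: PD_val_simps(4) bar_tr_zero)
  next
    fix x y z
    assume x: "x \<in> carrier (PD_val R \<Lambda>)" and y: "y \<in> carrier (PD_val R \<Lambda>)" and z: "z \<in> carrier (PD_val R \<Lambda>)"
    show "x \<oplus>\<^bsub>PD_val R \<Lambda>\<^esub> y \<oplus>\<^bsub>PD_val R \<Lambda>\<^esub> z = x \<oplus>\<^bsub>PD_val R \<Lambda>\<^esub> (y \<oplus>\<^bsub>PD_val R \<Lambda>\<^esub> z)"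
      unfolding PD_val_simps(3)
      by (rule restrict_ext)
         (use ring.ring_simprules(7)[OF ring_bar[OF q]] mem[OF x] mem[OF y] mem[OF z] in auto)
  next
    fix x assume x: "x \<in> carrier (PD_val R \<Lambda>)"
    show "\<zero>\<^bsub>PD_val R \<Lambda>\<^esub> \<oplus>\<^bsub>PD_val R \<Lambda>\<^esub> x = x"
      unfolding PD_val_simps(3,4)
      by (rule extensionalityI[OF restrict_extensional exten[OF x]])
         (use ring.ring_simprules(8)[OF ring_bar[OF q]] mem[OF x] in auto)
  qed
qed

text \<open>The action permutes the components satisfying an invariant condition among themselves
  and sends zero to zero. Divided monomials enter the carrier in this way.\<close>

lemma PD_val_mask:
  assumes p: "is_partition \<Lambda>" and x: "x \<in> carrier (PD_val R \<Lambda>)"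
    and P: "\<And>\<sigma> \<Gamma>. \<sigma> \<in> Sym \<Lambda> \<Longrightarrow> \<Gamma> \<preceq> \<Lambda> \<Longrightarrow> P (transport (inv_into UNIV \<sigma>) \<Gamma>) \<longleftrightarrow> P \<Gamma>"
  shows "(\<lambda>\<Gamma>\<in>{\<Gamma>. \<Gamma> \<preceq> \<Lambda>}. if P \<Gamma> then x \<Gamma> else \<zero>\<^bsub>bar R \<Gamma>\<^esub>) \<in> carrier (PD_val R \<Lambda>)"
proof -
  have z: "\<zero>\<^bsub>bar R \<Gamma>\<^esub> \<in> carrier (bar R \<Gamma>)" if "\<Gamma> \<preceq> \<Lambda>" for \<Gamma>
    using that ring.ring_simprules(2)[OF ring_bar] by (simp add: refines_le_iff)
  show ?thesis
    using x P Sym_transport[OF p] z unfolding PD_carrier_iff by (auto simp: bar_tr_zero)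
qed

lemma eta_closed:
  assumes p: "is_partition \<Lambda>" and z: "z \<in> carrier (val R \<Lambda>)"
  shows "eta R \<Lambda> z \<in> carrier (PD_val R \<Lambda>)"
proof -
  have "bar_proj R \<Gamma> (res R \<Gamma> \<Lambda> id z) \<in> carrier (bar R \<Gamma>)" if "\<Gamma> \<preceq> \<Lambda>" for \<Gamma>
    using that z by (intro bar_proj_closed res_closed) (auto simp: refines_le_iff refines_le_morphism)
  moreover have "bar_tr R T \<Gamma> \<sigma> (bar_proj R T (res R T \<Lambda> id z)) = bar_proj R \<Gamma> (res R \<Gamma> \<Lambda> id z)"
    if s: "\<sigma> \<in> Sym \<Lambda>" "\<Gamma> \<preceq> \<Lambda>" and T: "T = transport (inv_into UNIV \<sigma>) \<Gamma>" for \<sigma> \<Gamma> T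
  proof -
    have i: "isomorphism T \<Gamma> \<sigma>" and t: "T \<preceq> \<Lambda>" using Sym_transport[OF p s] T by auto
    let ?g = "inv_into (pts T) \<sigma>"
    have m: "morphism \<Gamma> T ?g" using isomorphism_inv[OF i] by (rule isomorphism_morphism)
    have mt: "morphism T \<Lambda> id" using t by (rule refines_le_morphism)
    have mg: "morphism \<Gamma> \<Lambda> id" using s(2) by (rule refines_le_morphism)
    have b: "bij_betw \<sigma> (pts T) (pts \<Gamma>)" using i by (simp add: isomorphism_iff)
    have c: "res R T \<Lambda> id z \<in> carrier (val R T)" using mt z by (rule res_closed)
    have "tr R T \<Gamma> \<sigma> (res R T \<Lambda> id z) = res R \<Gamma> T ?g (res R T \<Lambda> id z)"
      using i c by (rule tr_iso)
    also have "\<dots> = res R \<Gamma> \<Lambda> (id \<circ> ?g) z" using res_comp[OF m mt z] by simp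
    \<comment> \<open>Here invariance comes from \<sigma> preserving the blocks of \<Lambda>: its
      inverse, followed by the refinement into \<Lambda>, is 2-isomorphic to the refinement
      \<open>\<Gamma> \<preceq> \<Lambda>\<close>.\<close>
    also have "\<dots> = res R \<Gamma> \<Lambda> id z"
    proof (rule res_two_iso[OF morphism_comp[OF m mt] mg _ z])
      have "(?g x, x) \<in> rel \<Lambda>" if x: "x \<in> pts \<Gamma>" for x
      proof -
        have "\<sigma> (?g x) = x" using bij_betw_inv_into_right[OF b x] .
        moreover have "?g x \<in> pts \<Lambda>"
          using m x t by (auto simp: morphism_def refines_le_def dest: bij_betwE)
        ultimately show ?thesis using Sym_rel[OF p s(1), of "?g x"] by simp
      qed
      then show "two_iso \<Gamma> \<Lambda> (id \<circ> ?g) id" by (simp add: two_iso_def)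
    qed
    finally show ?thesis using bar_tr_bar_proj[OF i c] by simp
  qed
  ultimately show ?thesis
    using Sym_transport(1)[OF p] unfolding PD_carrier_iff by (auto simp: eta_def)
qed

end

section \<open>Exponential elements\<close>

context partition_ring
begin

lemma res_std_cong:
  assumes "is_partition \<Lambda>" "bij_betw f (pts \<Lambda>) {1..n}" "bij_betw g (pts \<Lambda>) {1..n}"
    "z \<in> carrier (val R (std n))"
  shows "res R \<Lambda> (std n) f z = res R \<Lambda> (std n) g z"
  using assms by (intro res_two_iso morphism_std two_iso_std)

text \<open>Frees later arguments from the bijection chosen in \<open>to_block\<close>: its transfer
  is the restriction along the inverse, for which any bijection \<open>h\<close> may be
  substituted.\<close>

lemma to_block_bar_proj:
  assumes B: "finite B" and z: "z \<in> carrier (val R (std (card B)))"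
    and h: "bij_betw h B {1..card B}"
  shows "to_block R B (bar_proj R (std (card B)) z) =
    bar_proj R (indisc B) (res R (indisc B) (std (card B)) h z)"
proof -
  define f where "f = (SOME f. bij_betw f {1..card B} B)"
  have f: "bij_betw f {1..card B} B"
    unfolding f_def using someI[of "\<lambda>f. bij_betw f {1..card B} B", OF bij_betw_inv_into[OF h]] .
  have i: "isomorphism (std (card B)) (indisc B) f"
    using f B is_partition_std[of "card B"] is_partition_indisc[OF B]
    unfolding isomorphism_iff by (auto simp: std_def indisc_def dest: bij_betwE)
  have g: "bij_betw (inv_into {1..card B} f) (pts (indisc B)) {1..card B}"
    using bij_betw_inv_into[OF f] by simp
  have "tr R (std (card B)) (indisc B) f z =
      res R (indisc B) (std (card B)) (inv_into {1..card B} f) z"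
    using tr_iso[OF i z] by (simp only: pts_std)
  also have "\<dots> = res R (indisc B) (std (card B)) h z"
    using g h by (intro res_std_cong[OF is_partition_indisc[OF B] _ _ z]) simp_all
  finally show ?thesis
    unfolding to_block_def f_def[symmetric] bar_tr_bar_proj[OF i z] by (rule arg_cong)
qed

text \<open>The enumeration \<open>f\<close> and the length \<open>n\<close> vary in the induction,
  since the remaining blocks are counted afresh at each stage. Blocks are nonempty, so only
  \<open>y k\<close> with positive \<open>k\<close> occurs.\<close>

lemma block_prod_list_exponential:
  assumes r: "exponential R r"
    and y: "\<And>k. k > 0 \<Longrightarrow> y k = bar_proj R (std k) (r k)"
  shows "distinct Bs \<Longrightarrow> pairwise disjnt (set Bs) \<Longrightarrow> (\<And>B. B \<in> set Bs \<Longrightarrow> finite B \<and> B \<noteq> {}) \<Longrightarrow>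
    bij_betw f (\<Union> (set Bs)) {1..n} \<Longrightarrow>
    block_prod_list R y Bs = bar_proj R (of_blocks (set Bs)) (res R (of_blocks (set Bs)) (std n) f (r n))"
proof (induction Bs arbitrary: f n)
  case Nil
  \<comment> \<open>An empty union forces \<open>n = 0\<close>, and the claim becomes the
    normalization \<open>r 0 = unt R 1\<close>.\<close>
  then have n: "n = 0" by (auto simp: bij_betw_def)
  have e: "of_blocks {} = std 0" by (simp add: of_blocks_def std_def indisc_def)
  have r0: "r 0 = unt R 1" and c: "unt R 1 \<in> carrier (val R (std 0))"
    using r unt_hom(2) by (simp_all add: exponential_def)
  have "res R (std 0) (std 0) f (unt R 1) = unt R 1"
    using res_std_cong[where f = f and g = id, OF is_partition_std _ _ c] res_id[OF is_partition_std c]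
    by (simp add: bij_betw_def)
  then show ?case using n e r0 by simp
next
  case (Cons B Bs)
  let ?U = "\<Union> (set Bs)" and ?W = "of_blocks (set Bs)" and ?E = "of_blocks (set (B # Bs))"
  have c: "r k \<in> carrier (val R (std k))" for k using r by (simp add: exponential_def series_def)
  have fin: "finite B" "B \<noteq> {}" "finite ?U" using Cons.prems(3) by auto
  \<comment> \<open>\<open>pairwise\<close> compares only different members, so distinctness of the
    list is needed to rule out that \<open>B\<close> recurs.\<close>
  have d: "B \<inter> ?U = {}" using Cons.prems(1,2) by (fastforce simp: pairwise_def disjnt_def)
  have dW: "pairwise disjnt (set Bs)" using Cons.prems(2) by (simp add: pairwise_insert)
  have W: "is_partition ?W"
    using Cons.prems dW by (intro is_partition_of_blocks) auto
  have E: "is_partition ?E"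
    using Cons.prems by (intro is_partition_of_blocks) auto
  have pI: "is_partition (indisc B)" using fin(1) by (rule is_partition_indisc)
  \<comment> \<open>Arbitrary enumerations of the tail and of \<open>B\<close>; they need not be
    related to \<open>f\<close>.\<close>
  obtain g where g: "bij_betw g ?U {1..card ?U}"
    using fin(3) by (metis finite_same_card_bij finite_atLeastAtMost card_atLeastAtMost diff_Suc_1)
  obtain h where h: "bij_betw h B {1..card B}"
    using fin(1) by (metis finite_same_card_bij finite_atLeastAtMost card_atLeastAtMost diff_Suc_1)
  let ?b = "card B" and ?u = "card ?U"
  have n: "n = ?b + ?u"
    using bij_betw_same_card[OF Cons.prems(4)] card_Un_disjoint[OF fin(1,3) d] by simp
  have IH: "block_prod_list R y Bs = bar_proj R ?W (res R ?W (std ?u) g (r ?u))"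
    using Cons.prems dW g by (intro Cons.IH) auto
  have mh: "morphism (indisc B) (std ?b) h" using pI h by (intro morphism_std) auto
  have mg: "morphism ?W (std ?u) g" using W g by (intro morphism_std) (auto simp: of_blocks_def)
  let ?D = "indisc B \<uplus> ?W"
  let ?k = "concat_map ?b \<circ> dsum_map h g"
  have md: "morphism ?D (std ?b \<uplus> std ?u) (dsum_map h g)" using mh mg by (rule morphism_dsum_map)
  have mk: "morphism ?D (std (?b + ?u)) ?k" using md morphism_concat_map by (rule morphism_comp)
  have "block_prod_list R y (B # Bs) =
      bar_tr R ?D ?E untag (bar_ext R (indisc B) ?W
        (bar_proj R (indisc B) (res R (indisc B) (std ?b) h (r ?b)))
        (bar_proj R ?W (res R ?W (std ?u) g (r ?u))))"
    using IH y[of ?b] to_block_bar_proj[OF fin(1) c h] fin by (simp add: card_gt_0_iff)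
  also have "\<dots> = bar_tr R ?D ?E untag (bar_proj R ?D
      (ext R (indisc B) ?W (res R (indisc B) (std ?b) h (r ?b)) (res R ?W (std ?u) g (r ?u))))"
    using bar_ext_bar_proj[OF pI W res_closed[OF mh c] res_closed[OF mg c]] by simp
  also have "ext R (indisc B) ?W (res R (indisc B) (std ?b) h (r ?b)) (res R ?W (std ?u) g (r ?u)) =
      res R ?D (std ?b \<uplus> std ?u) (dsum_map h g) (ext R (std ?b) (std ?u) (r ?b) (r ?u))"
    using ext_res[OF mh mg c c] by simp
  \<comment> \<open>Exponentiality, read from right to left, fuses the two coefficients into
    one.\<close>
  also have "ext R (std ?b) (std ?u) (r ?b) (r ?u) =
      res R (std ?b \<uplus> std ?u) (std (?b + ?u)) (concat_map ?b) (r (?b + ?u))"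
    using r by (simp add: exponential_def)
  also have "res R ?D (std ?b \<uplus> std ?u) (dsum_map h g) \<dots> = res R ?D (std n) ?k (r n)"
    using res_comp[OF md morphism_concat_map c] n by simp
  also have "bar_tr R ?D ?E untag (bar_proj R ?D \<dots>) = bar_proj R ?E (res R ?E (std n) f (r n))"
  proof -
    have i: "isomorphism ?D ?E untag"
      using isomorphism_untag[OF W _ fin(1) d] E by simp
    let ?v = "inv_into (pts ?D) untag"
    have mv: "morphism ?E ?D ?v" using isomorphism_inv[OF i] by (rule isomorphism_morphism)
    have ck: "res R ?D (std n) ?k (r n) \<in> carrier (val R ?D)" using mk c n by (simp add: res_closed)
    have "tr R ?D ?E untag (res R ?D (std n) ?k (r n)) = res R ?E ?D ?v (res R ?D (std n) ?k (r n))"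
      using i ck by (rule tr_iso)
    also have "\<dots> = res R ?E (std n) (?k \<circ> ?v) (r n)"
      using res_comp[OF mv, of "std n" ?k "r n"] mk n c by simp
    \<comment> \<open>\<open>?k \<circ> ?v\<close> numbers \<open>B\<close> before the tail and may
      differ from \<open>f\<close>, but both are bijections onto \<open>{1..n}\<close>.\<close>
    also have "\<dots> = res R ?E (std n) f (r n)"
    proof (rule res_std_cong[OF E _ _ c])
      show "bij_betw (?k \<circ> ?v) (pts ?E) {1..n}"
        using morphism_comp[OF mv mk] n by (simp add: morphism_def)
      show "bij_betw f (pts ?E) {1..n}" using Cons.prems(4) by (simp add: of_blocks_def)
    qed
    finally show ?thesis using bar_tr_bar_proj[OF i ck] by simp
  qed
  finally show ?case .
qed

lemma block_prod_exponential:
  assumes r: "exponential R r" and y: "\<And>k. k > 0 \<Longrightarrow> y k = bar_proj R (std k) (r k)"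
    and \<Gamma>: "\<Gamma> \<preceq> std m"
  shows "block_prod R y \<Gamma> = eta R (std m) (r m) \<Gamma>"
proof -
  have p: "is_partition \<Gamma>" and pts: "pts \<Gamma> = {1..m}" using \<Gamma> by (auto simp: refines_le_iff)
  note b = blocks_partition[OF p]
  define Bs where "Bs = (SOME Bs. distinct Bs \<and> set Bs = blocks \<Gamma>)"
  have "\<exists>Bs. distinct Bs \<and> set Bs = blocks \<Gamma>"
    using finite_distinct_list[OF b(1)] by blast
  then have Bs: "distinct Bs" "set Bs = blocks \<Gamma>"
    using someI_ex unfolding Bs_def by (metis (mono_tags, lifting))+
  have "block_prod_list R y Bs =
      bar_proj R (of_blocks (set Bs)) (res R (of_blocks (set Bs)) (std m) id (r m))"
    using Bs b pts by (intro block_prod_list_exponential[OF r y]) auto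
  then show ?thesis
    using Bs(2) \<Gamma> by (simp add: block_prod_def Bs_def[symmetric] of_blocks_blocks[OF p] eta_def)
qed

lemma PD_exp_exponential:
  assumes r: "exponential R r" and x: "\<And>k. k > 0 \<Longrightarrow> x k (std k) = bar_proj R (std k) (r k)"
  shows "PD_exp R x m = eta R (std m) (r m)"
proof -
  let ?A = "{\<Gamma>. \<Gamma> \<preceq> std m}" and ?e = "eta R (std m) (r m)"
  have c: "r m \<in> carrier (val R (std m))" using r by (simp add: exponential_def series_def)
  note p = is_partition_std[of m]
  interpret abelian_monoid "PD_val R (std m)" using p by (rule abelian_monoid_PD_val)
  \<comment> \<open>The expected partial sum over \<open>L\<close>: the image of \<open>r m\<close>
    under \<open>eta\<close>, restricted to components whose block type lies in
    \<open>L\<close>.\<close>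
  let ?M = "\<lambda>L. \<lambda>\<Gamma>\<in>?A. if block_type \<Gamma> \<in> L then ?e \<Gamma> else \<zero>\<^bsub>bar R \<Gamma>\<^esub>"
  have M: "?M L \<in> carrier (PD_val R (std m))" for L
  proof (rule PD_val_mask[OF p eta_closed[OF p c]])
    fix \<sigma> \<Gamma> assume s: "\<sigma> \<in> Sym (std m)" and g: "\<Gamma> \<preceq> std m"
    have "inj (inv_into UNIV \<sigma>)" using s permutes_inj[OF permutes_inv] by (auto simp: Sym_def)
    then have "block_type (transport (inv_into UNIV \<sigma>) \<Gamma>) = block_type \<Gamma>"
      using g by (intro block_type_transport) (auto simp: refines_le_iff intro: inj_on_subset)
    then show "block_type (transport (inv_into UNIV \<sigma>) \<Gamma>) \<in> L \<longleftrightarrow> block_type \<Gamma> \<in> L" by simp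
  qed
  have dm: "divided_monomial R m x l = ?M {l}" for l
    unfolding divided_monomial_def
    by (rule restrict_ext) (auto simp: block_type_def fun_eq_iff block_prod_exponential[OF r x])
  have "finsum (PD_val R (std m)) (divided_monomial R m x) L = ?M L" if "finite L" for L
    using that
  proof (induction L)
    case empty
    then show ?case by (simp add: PD_val_simps(4))
  next
    case (insert l L)
    have "?M {l} \<oplus>\<^bsub>PD_val R (std m)\<^esub> ?M L = ?M (insert l L)"
      unfolding PD_val_simps(3)
    proof (rule restrict_ext)
      fix \<Gamma> assume "\<Gamma> \<in> ?A"
      then interpret B: ring "bar R \<Gamma>" by (intro ring_bar) (simp add: refines_le_iff)
      have "?e \<Gamma> \<in> carrier (bar R \<Gamma>)"
        using eta_closed[OF p c] \<open>\<Gamma> \<in> ?A\<close> by (auto simp: PD_val_simps)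
      \<comment> \<open>As \<open>l\<close> is not in \<open>L\<close>, at least one of the two
        terms is zero.\<close>
      then show "?M {l} \<Gamma> \<oplus>\<^bsub>bar R \<Gamma>\<^esub> ?M L \<Gamma> =
          (if block_type \<Gamma> \<in> insert l L then ?e \<Gamma> else \<zero>\<^bsub>bar R \<Gamma>\<^esub>)"
        using \<open>\<Gamma> \<in> ?A\<close> insert.hyps(2) by auto
    qed
    moreover have "finsum (PD_val R (std m)) (divided_monomial R m x) (insert l L) =
        ?M {l} \<oplus>\<^bsub>PD_val R (std m)\<^esub> ?M L"
    proof -
      have f: "divided_monomial R m x \<in> L \<rightarrow> carrier (PD_val R (std m))"
        "divided_monomial R m x l \<in> carrier (PD_val R (std m))"
        using M[of "{_}"] unfolding dm by blast+
      show ?thesis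
        unfolding finsum_insert[where f = "divided_monomial R m x", OF insert.hyps f] insert.IH dm by (rule refl)
    qed
    ultimately show ?case by simp
  qed
  then have "PD_exp R x m = ?M (exponents m)"
    using finite_exponents by (simp add: PD_exp_def)
  \<comment> \<open>The block type of every refinement of \<open>std m\<close> has weight
    \<open>m\<close>, so this mask removes nothing.\<close>
  also have "\<dots> = ?e"
  proof (rule extensionalityI[of _ ?A])
    fix \<Gamma> assume "\<Gamma> \<in> ?A"
    then have "block_type \<Gamma> \<in> exponents m"
      using block_type_exponents[of \<Gamma>] by (simp add: refines_le_iff)
    then show "?M (exponents m) \<Gamma> = ?e \<Gamma>" using \<open>\<Gamma> \<in> ?A\<close> by simp
  qed (simp_all add: eta_def)
  finally show ?thesis .
qed

text \<open>At the top index the restriction is along the identity and \<open>top_one\<close> is the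
  unit. This supplies the hypothesis on \<open>x\<close> in
  \<open>PD_exp_exponential\<close>.\<close>

lemma eta_mult_top_one:
  assumes "z \<in> carrier (val R (std k))"
  shows "(eta R (std k) z \<otimes>\<^bsub>PD_val R (std k)\<^esub> top_one R k) (std k) = bar_proj R (std k) z"
proof -
  have p: "is_partition (std k)" by (rule is_partition_std)
  interpret ring "bar R (std k)" using p by (rule ring_bar)
  have "std k \<preceq> std k" using p by (simp add: refines_le_iff)
  then show ?thesis
    using assms p by (simp add: PD_val_simps(2) eta_def top_one_def top_incl_def res_id bar_proj_closed)
qed

end

theorem theorem1p2:
  fixes R :: "'a pfunctor" and r :: "nat \<Rightarrow> 'a"
  assumes "partition_ring R"
    and "exponential R r"
  shows "(\<lambda>m. eta R (std m) (r m)) \<in> carrier (series (PD R)) \<and>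
    (\<lambda>m. eta R (std m) (r m)) =
    PD_exp R (\<lambda>k. if k = 0 then \<zero>\<^bsub>val (PD R) (std 0)\<^esub>
      else eta R (std k) (r k) \<otimes>\<^bsub>val (PD R) (std k)\<^esub> top_one R k)"
proof -
  interpret partition_ring R by fact
  have c: "r k \<in> carrier (val R (std k))" for k
    using assms(2) by (simp add: exponential_def series_def)
  show ?thesis
  proof
    show "(\<lambda>m. eta R (std m) (r m)) \<in> carrier (series (PD R))"
      using eta_closed[OF is_partition_std c] by (simp add: series_def)
    show "(\<lambda>m. eta R (std m) (r m)) =
      PD_exp R (\<lambda>k. if k = 0 then \<zero>\<^bsub>val (PD R) (std 0)\<^esub>
        else eta R (std k) (r k) \<otimes>\<^bsub>val (PD R) (std k)\<^esub> top_one R k)"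
      by (rule ext, rule PD_exp_exponential[OF assms(2), symmetric]) (simp add: eta_mult_top_one c)
  qed
qed

end
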